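(* Let $p\in(0,1)$, and let $c_L(p)$, $c_U(p)$ be defined as follows: let $s=s(p)$ be the unique solution in $(0,1)$ to $s\log\left(\frac{(1-p)(2-s)}{1-s}\right)=1$, let $p_0\approx0.206$ be the unique solution in $(0,1/2)$ to $\log\left(\frac{1-p}{p}\right)=\frac{1-p}{1-2p}$, let $c_L(p)=\exp(1/s)s(2-s)p$, and let $c_U(p)=c_L(p)$ if $p_0\le p<1$ and $c_U(p)=\left(\log\frac{1-p}{p}\right)^{-1}$ if $0<p<p_0$. Then for every fixed $\varepsilon>0$, a.a.s. as $n\to\infty$ the diameter of the random-surfer tree model with $n$ vertices and parameter $p$ is between $(2c_L(p)-\varepsilon)\log n$ and $(2c_U(p)+\varepsilon)\log n$.
   Context: $\mathrm{Geo}(p)$ denotes a geometric random variable with $\Pr[\mathrm{Geo}(p)=k]=(1-p)^kp$ for integers $k\ge0$. The random-surfer tree model with parameter $p$ and $n$ vertices: start with a root $v_0$ having one self-loop; at each step $s$, $1\le s\le n-1$, a new vertex $v_s$ appears, chooses $u$ uniformly at random from $\{v_0,\dots,v_{s-1}\}$ and a fresh $X=\mathrm{Geo}(p)$, performs a simple random walk of length $X$ from $u$ along out-edges, and creates an edge from $v_s$ to the last vertex of the walk; finally delete the root's self-loop and ignore edge directions. The diameter is the maximum graph distance between two vertices. A.a.s. means with probability tending to $1$ as $n\to\infty$; $\log$ is natural. *)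

theory Defs
  imports "HOL-Probability.Probability"
begin

text \<open>Random-surfer tree model. Vertices are v_0, ..., v_{n-1}, encoded as 0, ..., n-1.
  A state is the out-neighbour function f: vertex s (s >= 1) has its unique out-edge to f s,
  and the root 0 has a self-loop, encoded as f 0 = 0. Since every vertex has exactly one
  out-edge, the simple random walk of length X from u along out-edges ends at (f ^^ X) u.\<close>

definition rs_step :: "real \<Rightarrow> nat \<Rightarrow> (nat \<Rightarrow> nat) \<Rightarrow> (nat \<Rightarrow> nat) pmf" where
  "rs_step p s f =
     do { u \<leftarrow> pmf_of_set {..<s};
          X \<leftarrow> geometric_pmf p;
          return_pmf (f(s := (f ^^ X) u)) }"

fun rs_tree :: "real \<Rightarrow> nat \<Rightarrow> (nat \<Rightarrow> nat) pmf" where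
  "rs_tree p 0 = return_pmf (\<lambda>_. 0)"
| "rs_tree p (Suc 0) = return_pmf (\<lambda>_. 0)"
| "rs_tree p (Suc (Suc k)) = bind_pmf (rs_tree p (Suc k)) (rs_step p (Suc k))"

text \<open>Undirected edges of the tree on n vertices (root self-loop deleted).\<close>
definition rs_edges :: "(nat \<Rightarrow> nat) \<Rightarrow> nat \<Rightarrow> (nat \<times> nat) set" where
  "rs_edges f n = {(a, b). a < n \<and> b < n \<and>
      ((1 \<le> a \<and> f a = b) \<or> (1 \<le> b \<and> f b = a))}"

definition rs_dist :: "(nat \<Rightarrow> nat) \<Rightarrow> nat \<Rightarrow> nat \<Rightarrow> nat \<Rightarrow> nat" where
  "rs_dist f n a b = (LEAST k. (a, b) \<in> rs_edges f n ^^ k)"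

definition rs_diam :: "(nat \<Rightarrow> nat) \<Rightarrow> nat \<Rightarrow> nat" where
  "rs_diam f n = Max {rs_dist f n a b | a b. a < n \<and> b < n}"

definition s_of :: "real \<Rightarrow> real" where
  "s_of p = (THE s. 0 < s \<and> s < 1 \<and> s * ln ((1 - p) * (2 - s) / (1 - s)) = 1)"

definition p0 :: real where
  "p0 = (THE q. 0 < q \<and> q < 1/2 \<and> ln ((1 - q) / q) = (1 - q) / (1 - 2 * q))"

definition cL :: "real \<Rightarrow> real" where
  "cL p = exp (1 / s_of p) * s_of p * (2 - s_of p) * p"

definition cU :: "real \<Rightarrow> real" where
  "cU p = (if p0 \<le> p then cL p else 1 / ln ((1 - p) / p))"

end

theory Submission
  imports Defs "HOL-Real_Asymp.Real_Asymp"
begin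

text \<open>Let \<open>D v\<close> be the distance of \<open>v\<close> from the root. A vertex whose walk of length \<open>X\<close> starts at \<open>u\<close>
  has \<open>D v = 1 + max (D u - X) 0\<close>, so the depths form a branching random walk indexed by a random
  recursive tree and reflected at 0. For \<open>z > 1\<close>, reflection adds only a bounded amount to
  the expectation of \<open>z ^ D v\<close>, so the expected sum of \<open>z ^ D v\<close> over the tree is at most about
  \<open>n\<close> to the power \<open>max (growth p z) 1\<close>; optimising \<open>z\<close> bounds the height by \<open>cU p * ln n\<close>, and the
  diameter is at most twice the height.

  For the lower bound, split the non-root vertices into the subtree of vertex 1 and the rest; the
  distance between vertices of different classes is the sum of their depths. In each class the number
  of vertices of depth at least \<open>h\<close> grows at least like a supercritical branching process with
  increments \<open>1 - X\<close>. Over rounds in which \<open>n\<close> grows by a constant factor these numbers follow a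
  linear recursion up to Chernoff errors, and after a fixed number of rounds at least \<open>M\<close> vertices of
  depth \<open>h\<close> have produced at least \<open>2 M\<close> vertices of depth \<open>h + j\<close>, at a speed close to \<open>cL p\<close>. The
  failure probabilities of these blocks form a geometric series of sum \<open>O(1/M)\<close>.\<close>

subsection \<open>The constants\<close>

text \<open>Existence is the intermediate value theorem between 1/2 and a point close to 1. For
  uniqueness, the logarithm is positive at any solution, and both factors increase strictly from
  there on.\<close>

lemma s_of_unique:
  fixes p :: real
  assumes p: "0 < p" "p < 1"
  shows "\<exists>!s. 0 < s \<and> s < 1 \<and> s * ln ((1 - p) * (2 - s) / (1 - s)) = 1"
proof -
  define L where "L s = (1 - p) * (2 - s) / (1 - s)" for s :: real
  have Lpos: "L s > 0" if "s < 1" for s using that p by (simp add: L_def)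
  have Lmono: "L s < L t" if "s < t" "t < 1" for s t
  proof -
    have e: "L s = (1 - p) * (1 + 1 / (1 - s))" if "s < 1" for s
      using that by (simp add: L_def divide_simps)
    have "1 / (1 - s) < 1 / (1 - t)" using that by (simp add: frac_less2)
    then show ?thesis using that p by (simp add: e)
  qed
  \<comment> \<open>Chosen so that \<open>L (1 - e)\<close> is at least
    \<open>(1 - p) / e = exp 4\<close>; the product is then at least 2 at the right
    endpoint.\<close>
  define e where "e = (1 - p) * exp (-4)"
  have "exp (-4::real) \<le> 1/2"
    using exp_ge_add_one_self[of "4::real"] by (simp add: exp_minus field_simps)
  then have "(1 - p) * exp (-4) < 1 * (1/2)" using p by (intro mult_less_le_imp_less) auto
  then have e: "0 < e" "e < 1/2" using p by (simp_all add: e_def)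
  have "\<exists>s\<ge>1/2. s \<le> 1 - e \<and> s * ln (L s) = 1"
  proof (rule IVT')
    have "ln (L (1/2)) \<le> L (1/2) - 1" by (intro ln_le_minus_one Lpos) auto
    also have "\<dots> \<le> 2" using p by (simp add: L_def)
    finally show "1/2 * ln (L (1/2)) \<le> 1" by simp
    have "exp 4 = (1 - p) / e" using p by (simp add: e_def exp_minus field_simps)
    also have "\<dots> \<le> L (1 - e)" using e p by (simp add: L_def divide_simps)
    finally have "4 \<le> ln (L (1 - e))" using Lpos[of "1 - e"] e by (simp add: ln_ge_iff)
    then have "(1/2) * 4 \<le> (1 - e) * ln (L (1 - e))" using e by (intro mult_mono) auto
    then show "1 \<le> (1 - e) * ln (L (1 - e))" by simp
    show "1/2 \<le> 1 - e" using e by simp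
    show "continuous_on {1/2..1 - e} (\<lambda>s. s * ln (L s))"
      unfolding L_def using e p by (intro continuous_intros) auto
  qed
  then obtain s where s: "1/2 \<le> s" "s \<le> 1 - e" "s * ln (L s) = 1" by blast
  have le: False if "0 < s" "s < t" "t < 1" "s * ln (L s) = 1" "t * ln (L t) = 1" for s t
  proof -
    have "ln (L s) > 0" using that by (metis zero_less_mult_pos zero_less_one)
    moreover have "ln (L s) < ln (L t)" using that Lmono Lpos by simp
    ultimately have "s * ln (L s) < t * ln (L t)" using that by (intro mult_strict_mono) auto
    then show False using that by simp
  qed
  show ?thesis
  proof (rule ex1I[of _ s])
    show "0 < s \<and> s < 1 \<and> s * ln ((1 - p) * (2 - s) / (1 - s)) = 1"
      using s e by (auto simp: L_def)
    show "t = s" if "0 < t \<and> t < 1 \<and> t * ln ((1 - p) * (2 - t) / (1 - t)) = 1" for t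
      using that le[of s t] le[of t s] s e by (fastforce simp: L_def)
  qed
qed

lemma s_of:
  assumes "0 < p" "p < 1"
  shows "0 < s_of p" "s_of p < 1" "s_of p * ln ((1 - p) * (2 - s_of p) / (1 - s_of p)) = 1"
  using theI'[OF s_of_unique[OF assms]] by (simp_all add: s_of_def)

text \<open>\<open>growth p z\<close> is the growth exponent of the sum of \<open>z\<close> to the depth of \<open>v\<close> over all
  vertices \<open>v\<close>, up to the reflection at the root; \<open>slope p z\<close> is \<open>z\<close> times its derivative in \<open>z\<close>.\<close>

definition growth :: "real \<Rightarrow> real \<Rightarrow> real" where
  "growth p z = p * z\<^sup>2 / (z - (1 - p))"

definition slope :: "real \<Rightarrow> real \<Rightarrow> real" where
  "slope p z = growth p z * (2 - z / (z - (1 - p)))"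

section \<open>Identities at \<open>z = exp (1 / s_of p)\<close>\<close>

lemma exp_inverse_s_of:
  assumes "0 < p" "p < 1"
  shows "exp (1 / s_of p) = (1 - p) * (2 - s_of p) / (1 - s_of p)"
proof -
  note s = s_of[OF assms]
  have "ln ((1 - p) * (2 - s_of p) / (1 - s_of p)) = 1 / s_of p"
    using s by (simp add: field_simps)
  moreover have "(1 - p) * (2 - s_of p) / (1 - s_of p) > 0" using s assms by simp
  ultimately show ?thesis by (metis exp_ln)
qed

lemma two_minus_s_of:
  assumes "0 < p" "p < 1" and z: "z = exp (1 / s_of p)"
  shows "z / (z - (1 - p)) = 2 - s_of p"
proof -
  note s = s_of[OF assms(1,2)]
  have "z = (1 - p) * (2 - s_of p) / (1 - s_of p)" using exp_inverse_s_of assms by simp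
  moreover from this have "z - (1 - p) = (1 - p) / (1 - s_of p)" using s by (simp add: divide_simps) algebra
  ultimately show ?thesis using s assms by simp
qed

text \<open>Since \<open>ln z = 1 / s_of p\<close>, both formulas together give
  \<open>slope p z * ln z = growth p z\<close>: this \<open>z\<close> is the stationary point of
  \<open>growth p z / ln z\<close>, and \<open>cL p\<close> is the value there.\<close>

lemma cL_eq:
  assumes "0 < p" "p < 1" and z: "z = exp (1 / s_of p)"
  shows "cL p = growth p z * s_of p" "cL p = slope p z"
proof -
  have "growth p z = p * z * (z / (z - (1 - p)))" by (simp add: growth_def power2_eq_square)
  then have "growth p z = p * z * (2 - s_of p)" using two_minus_s_of[OF assms] by simp
  then show "cL p = growth p z * s_of p" by (simp add: cL_def z)
  then show "cL p = slope p z" using two_minus_s_of[OF assms] by (simp add: slope_def)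
qed

lemma cL_pos: "0 < p \<Longrightarrow> p < 1 \<Longrightarrow> 0 < cL p"
  using s_of[of p] by (simp add: cL_def)

text \<open>At \<open>z0\<close> the last inequality is an equality and \<open>slope\<close> equals
  \<open>cL p\<close>. Slightly to the left of \<open>z0\<close>, continuity keeps
  \<open>slope\<close> above \<open>c\<close> while the inequality becomes strict; the strictness is
  the supercriticality needed for the lower bound.\<close>

lemma slope_approx:
  assumes p: "0 < p" "p < 1" and c: "c < cL p"
  obtains z where "1 < z" "c < slope p z" "slope p z * ln z < growth p z"
proof -
  define z0 where "z0 = exp (1 / s_of p)"
  note s = s_of[OF p]
  have z0: "1 < z0" using s by (simp add: z0_def)
  have "continuous (at_left z0) (slope p)"
    unfolding slope_def growth_def using z0 p by (intro continuous_intros) auto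
  then have "(slope p \<longlongrightarrow> cL p) (at_left z0)"
    using cL_eq(2)[OF p z0_def] by (simp add: continuous_within)
  then have "eventually (\<lambda>z. c < slope p z) (at_left z0)" using c by (simp add: order_tendsto_iff)
  moreover have "eventually (\<lambda>z. z \<in> {1<..<z0}) (at_left z0)"
    using z0 eventually_at_left_real by blast
  ultimately have "eventually (\<lambda>z. c < slope p z \<and> z \<in> {1<..<z0}) (at_left z0)"
    by eventually_elim auto
  then obtain z where z: "c < slope p z" "1 < z" "z < z0"
    using eventually_happens'[of "at_left z0"] by auto
  \<comment> \<open>The ratio of \<open>slope\<close> to \<open>growth\<close>. It increases with
    \<open>z\<close>, and \<open>g z0 * ln z0 = 1\<close>.\<close>
  define g where "g z = 2 - z / (z - (1 - p))" for z
  have g: "g z = 1 - (1 - p) / (z - (1 - p))" if "z > 1" for z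
    using that p by (simp add: g_def divide_simps)
  have "(1 - p) / (z0 - (1 - p)) < (1 - p) / (z - (1 - p))" using z p by (intro divide_strict_left_mono) auto
  then have gz: "g z < g z0" using g z z0 by simp
  have g0: "g z0 = s_of p" using two_minus_s_of[OF p z0_def] by (simp add: g_def)
  have "g z * ln z \<le> g z0 * ln z" using gz z by (intro mult_right_mono) auto
  also have "\<dots> < g z0 * ln z0" using z g0 s by (intro mult_strict_left_mono) auto
  also have "\<dots> = 1" using g0 s by (simp add: z0_def)
  finally have "g z * ln z < 1" .
  moreover have "growth p z > 0" using z p by (simp add: growth_def)
  ultimately have "slope p z * ln z < growth p z" by (simp add: slope_def g_def mult.assoc)
  with z show ?thesis using that by blast
qed

text \<open>The logarithm decreases and the fraction increases on (0, 1/2), so their difference is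
  strictly decreasing; it changes sign between 1/10 and 1/3. The monotonicity is stated separately
  to compare \<open>p\<close> with \<open>p0\<close> later.\<close>

lemma p0_unique: "\<exists>!q::real. 0 < q \<and> q < 1/2 \<and> ln ((1 - q) / q) = (1 - q) / (1 - 2 * q)"
  and p0_mono: "0 < q \<Longrightarrow> q < r \<Longrightarrow> r < 1/2 \<Longrightarrow>
    ln ((1 - r) / r) - (1 - r) / (1 - 2 * r) < ln ((1 - q) / q) - (1 - q) / (1 - 2 * q)"
  for q r :: real
proof -
  define g where "g q = ln ((1 - q) / q) - (1 - q) / (1 - 2 * q)" for q :: real
  have mono: "g r < g q" if "0 < q" "q < r" "r < 1/2" for q r
  proof -
    have "(1 - r) / r < (1 - q) / q" using that by (simp add: frac_less)
    then have "ln ((1 - r) / r) < ln ((1 - q) / q)" using that by simp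
    moreover have "(1 - q) / (1 - 2 * q) < (1 - r) / (1 - 2 * r)"
      using that by (simp add: divide_simps) (simp add: algebra_simps)
    ultimately show ?thesis by (simp add: g_def)
  qed
  then show "0 < q \<Longrightarrow> q < r \<Longrightarrow> r < 1/2 \<Longrightarrow>
    ln ((1 - r) / r) - (1 - r) / (1 - 2 * r) < ln ((1 - q) / q) - (1 - q) / (1 - 2 * q)"
    by (simp add: g_def)
  have "\<exists>q\<ge>1/10. q \<le> 1/3 \<and> g q = 0"
  proof (rule IVT2')
    have "ln (9::real) = 2 * ln 3" using ln_realpow[of 3 2] by simp
    moreover have "ln (3::real) \<ge> 1" using exp_le by (simp add: ln_ge_iff)
    ultimately show "0 \<le> g (1/10)" by (simp add: g_def)
    show "g (1/3) \<le> 0" using ln_le_minus_one[of "2::real"] by (simp add: g_def)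
    show "continuous_on {1/10..1/3} g" unfolding g_def by (intro continuous_intros) auto
  qed simp
  then obtain q where q: "1/10 \<le> q" "q \<le> 1/3" "g q = 0" by blast
  show "\<exists>!q::real. 0 < q \<and> q < 1/2 \<and> ln ((1 - q) / q) = (1 - q) / (1 - 2 * q)"
  proof (rule ex1I[of _ q])
    show "0 < q \<and> q < 1/2 \<and> ln ((1 - q) / q) = (1 - q) / (1 - 2 * q)" using q by (simp add: g_def)
    show "r = q" if "0 < r \<and> r < 1/2 \<and> ln ((1 - r) / r) = (1 - r) / (1 - 2 * r)" for r
      using that q mono[of q r] mono[of r q] by (cases r q rule: linorder_cases) (auto simp: g_def)
  qed
qed

lemma p0: "0 < p0" "p0 < 1/2" "ln ((1 - p0) / p0) = (1 - p0) / (1 - 2 * p0)"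
  using theI'[OF p0_unique] by (simp_all add: p0_def)

text \<open>The upper bound needs a \<open>z\<close> for which \<open>cU p * ln z\<close> dominates
  both \<open>growth p z\<close> and 1, the latter being the cost of reflection at the root. The two
  cases of \<open>cU\<close> correspond to which of the two constraints dictates
  \<open>z\<close>.\<close>

lemma growth_cU:
  assumes p: "0 < p" "p < 1"
  obtains z where "1 < z" "1 \<le> cU p * ln z" "growth p z \<le> cU p * ln z"
proof (cases "p0 \<le> p")
  case True
  define z where "z = exp (1 / s_of p)"
  note s = s_of[OF p]
  have z: "1 < z" using s by (simp add: z_def)
  have "cU p * ln z = cL p / s_of p" using True by (simp add: cU_def z_def)
  then have eq: "cU p * ln z = growth p z" using cL_eq[OF p z_def] s by simp
  \<comment> \<open>This amounts to \<open>growth p z \<ge> 1\<close>, because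
    \<open>p * z\<^sup>2 - (z - (1 - p))\<close> factors as
    \<open>(z - 1) * (p * z - (1 - p))\<close>.\<close>
  have "1 - p \<le> p * z"
  proof (cases "p < 1/2")
    case True
    have "ln ((1 - p) / p) \<le> (1 - p) / (1 - 2 * p)"
      using p0_mono[of p0 p] p0 True \<open>p0 \<le> p\<close> by (cases "p = p0") auto
    \<comment> \<open>The value that, put in place of \<open>s_of p\<close>, would give
      \<open>z = (1 - p) / p\<close>. The inequality defining the side of \<open>p0\<close> says
      that \<open>t * ln ((1 - p) / p)\<close> is at most 1, hence \<open>t\<close> cannot exceed
      \<open>s_of p\<close>.\<close>
    define t where "t = (1 - 2 * p) / (1 - p)"
    have t: "0 < t" "t < 1" "(2 - t) / (1 - t) = 1 / p"
      using True p by (simp_all add: t_def divide_simps)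
    have "t * ln ((1 - p) / p) \<le> 1"
      using \<open>ln ((1 - p) / p) \<le> _\<close> True p by (simp add: t_def field_simps)
    have "t \<le> s_of p"
    proof (rule ccontr)
      assume "\<not> t \<le> s_of p"
      then have st: "s_of p < t" by simp
      then have "(2 - s_of p) / (1 - s_of p) < (2 - t) / (1 - t)"
        using t by (simp add: divide_simps) (simp add: algebra_simps)
      then have "(1 - p) * ((2 - s_of p) / (1 - s_of p)) < (1 - p) * ((2 - t) / (1 - t))"
        using p by (intro mult_strict_left_mono) auto
      then have "z < (1 - p) / p" using exp_inverse_s_of[OF p] t by (simp add: z_def)
      then have "ln z < ln ((1 - p) / p)" using z by simp
      then have "s_of p * ln z < t * ln ((1 - p) / p)"
        using st s z by (intro mult_strict_mono) auto
      then show False using \<open>t * ln ((1 - p) / p) \<le> 1\<close> s by (simp add: z_def)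
    qed
    then have "(2 - t) / (1 - t) \<le> (2 - s_of p) / (1 - s_of p)"
      using t s by (simp add: divide_simps) (simp add: algebra_simps)
    then have "(1 - p) * ((2 - t) / (1 - t)) \<le> (1 - p) * ((2 - s_of p) / (1 - s_of p))"
      using p by (intro mult_left_mono) auto
    then have "(1 - p) / p \<le> z" using exp_inverse_s_of[OF p] t by (simp add: z_def)
    then show ?thesis using p by (simp add: field_simps)
  next
    case False
    then have "(1/2) * 1 \<le> p * z" using z by (intro mult_mono) auto
    then show ?thesis using False by simp
  qed
  then have "(z - 1) * (p * z - (1 - p)) \<ge> 0" using z by simp
  then have "1 \<le> growth p z" using z p by (simp add: growth_def field_simps power2_eq_square)
  then show ?thesis using that z eq by simp
next
  case False
  then have p2: "p < 1/2" using p0 by simp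
  \<comment> \<open>The root of \<open>growth p z = 1\<close> other than 1.\<close>
  define z where "z = (1 - p) / p"
  have z: "1 < z" using p p2 by (simp add: z_def)
  have "z - (1 - p) = (1 - p)\<^sup>2 / p"
    using p by (simp add: z_def field_simps power2_eq_square)
  then have "growth p z = 1"
    using p by (simp add: growth_def) (simp add: z_def power2_eq_square)
  moreover have "cU p * ln z = 1"
    using False ln_gt_zero[OF z] by (simp add: cU_def flip: z_def)
  ultimately show ?thesis using that[of z] z by simp
qed

subsection \<open>The linear recursion for the front\<close>

text \<open>Geometric series in \<open>x = (1 - p) / z\<close> and its derivative. Here
  \<open>k\<close> is the walk length and \<open>1 - k\<close> the depth increment, so these are the
  tilted mass and first moment; truncation at \<open>N\<close> matches \<open>front\<close>.\<close>

lemma partial_growth_slope: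
  assumes p: "0 < p" "p < 1" and z: "1 < z"
  shows "(\<lambda>N. \<Sum>k<N. p * (1 - p) ^ k * (z / z ^ k)) \<longlonglongrightarrow> growth p z"
    and "(\<lambda>N. \<Sum>k<N. p * (1 - p) ^ k * (z / z ^ k) * (1 - real k)) \<longlonglongrightarrow> slope p z"
proof -
  define x where "x = (1 - p) / z"
  have x: "0 < x" "x < 1" using p z by (auto simp: x_def)
  have e: "p * (1 - p) ^ k * (z / z ^ k) = p * z * x ^ k" for k
    by (simp add: x_def power_divide)
  have zx: "z / (z - (1 - p)) = 1 / (1 - x)" using p z by (simp add: x_def field_simps)
  have g: "growth p z = p * z * (1 / (1 - x))"
    unfolding zx[symmetric] by (simp add: growth_def power2_eq_square)
  have 1: "(\<lambda>k. x ^ k) sums (1 / (1 - x))" using geometric_sums[of x] x by simp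
  then have "(\<lambda>k. p * (1 - p) ^ k * (z / z ^ k)) sums growth p z"
    unfolding e g by (rule sums_mult)
  then show "(\<lambda>N. \<Sum>k<N. p * (1 - p) ^ k * (z / z ^ k)) \<longlonglongrightarrow> growth p z"
    by (simp add: sums_def)
  have "(\<lambda>k. real (Suc k) * x ^ k) sums (1 / (1 - x)\<^sup>2)" using geometric_deriv_sums[of x] x by simp
  from sums_mult[OF sums_diff[OF sums_mult[OF 1, of 2] this], of "p * z"]
  have "(\<lambda>k. p * z * (2 * x ^ k - real (Suc k) * x ^ k)) sums (p * z * (2 * (1 / (1 - x)) - 1 / (1 - x)\<^sup>2))" .
  also have "p * z * (2 * (1 / (1 - x)) - 1 / (1 - x)\<^sup>2) = slope p z"
    unfolding slope_def zx g by (simp add: power2_eq_square algebra_simps)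
  also have "(\<lambda>k. p * z * (2 * x ^ k - real (Suc k) * x ^ k)) =
      (\<lambda>k. p * (1 - p) ^ k * (z / z ^ k) * (1 - real k))"
    unfolding e by (simp add: algebra_simps)
  finally show "(\<lambda>N. \<Sum>k<N. p * (1 - p) ^ k * (z / z ^ k) * (1 - real k)) \<longlonglongrightarrow> slope p z"
    by (simp add: sums_def)
qed

text \<open>Lower bounds for the number of vertices at relative level at least \<open>i\<close> after \<open>a\<close> rounds:
  \<open>b\<close> is the effective logarithmic length of a round, and the root distance of a new vertex is \<open>1 - k\<close>
  more than that of the start of its walk when the walk has length \<open>k\<close>.\<close>

fun front :: "real \<Rightarrow> nat \<Rightarrow> real \<Rightarrow> nat \<Rightarrow> int \<Rightarrow> real" where
  "front p N b 0 i = (if i \<le> 0 then 1 else 0)"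
| "front p N b (Suc a) i =
     front p N b a i + b * (\<Sum>k<N. p * (1 - p) ^ k * front p N b a (i - 1 + int k))"

lemma front_nonneg: "0 < p \<Longrightarrow> p < 1 \<Longrightarrow> 0 \<le> b \<Longrightarrow> 0 \<le> front p N b a i"
  by (induction a arbitrary: i) (auto intro!: add_nonneg_nonneg mult_nonneg_nonneg sum_nonneg)

text \<open>Even a walk of length 0 raises the level by only one, so the top level rises by at most
  one per round.\<close>

lemma front_eq_0: "i > int a \<Longrightarrow> front p N b a i = 0"
  by (induction a arbitrary: i) (auto intro!: sum.neutral)

text \<open>Under the law of increments tilted by \<open>exp l\<close>, a quadratic in the centred position has an
  explicit expectation, so it yields an exact solution of the recursion of \<open>front\<close>; being below
  the initial condition it stays below \<open>front\<close>. This is Chebyshev's inequality for the tilted walk.\<close>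

lemma front_ge:
  fixes p b l R :: real
  defines "w \<equiv> \<lambda>k::nat. p * (1 - p) ^ k * exp (l * (1 - real k))"
  defines "m0 \<equiv> \<lambda>N. (\<Sum>k<N. w k)"
    and "m1 \<equiv> \<lambda>N. (\<Sum>k<N. w k * (1 - real k))"
    and "m2 \<equiv> \<lambda>N. (\<Sum>k<N. w k * (1 - real k)\<^sup>2)"
  defines "\<Lambda> \<equiv> \<lambda>N. 1 + b * m0 N"
  defines "\<mu> \<equiv> \<lambda>N. b * m1 N / \<Lambda> N"
  defines "v \<equiv> \<lambda>N. b * m2 N / \<Lambda> N - (\<mu> N)\<^sup>2"
  assumes p: "0 < p" "p < 1" and b: "0 < b" and l: "0 < l" and R: "0 < R"
  shows "exp (- l * (of_int i + 2 * R)) * \<Lambda> N ^ a *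
      (1 - ((of_int i + R - \<mu> N * real a)\<^sup>2 + v N * real a) / R\<^sup>2) \<le> front p N b a i"
proof (induction a arbitrary: i)
  case 0
  define y where "y = (of_int i :: real)"
  show ?case
  \<comment> \<open>The quadratic is nonnegative exactly on this interval. There
    \<open>front\<close> is 1 and both factors are at most 1; elsewhere the left side is not
    positive.\<close>
  proof (cases "- 2 * R \<le> y \<and> y \<le> 0")
    case True
    have "\<bar>y + R\<bar> \<le> \<bar>R\<bar>" using True R by auto
    then have "(y + R)\<^sup>2 / R\<^sup>2 \<le> 1" using R by (simp only: abs_le_square_iff) simp
    then have "exp (- l * (y + 2 * R)) * (1 - (y + R)\<^sup>2 / R\<^sup>2) \<le> 1 * 1"
      using True l by (intro mult_mono) auto
    moreover have "i \<le> 0" using True by (simp add: y_def)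
    ultimately show ?thesis by (simp flip: y_def)
  next
    case False
    then have "R < \<bar>y + R\<bar>" using R by linarith
    then have "R\<^sup>2 < (y + R)\<^sup>2" using R abs_le_square_iff[of "y + R" R] by linarith
    then have "1 - (y + R)\<^sup>2 / R\<^sup>2 \<le> 0" using R by simp
    then have "exp (- l * (y + 2 * R)) * (1 - (y + R)\<^sup>2 / R\<^sup>2) \<le> 0"
      by (intro mult_nonneg_nonpos) auto
    then show ?thesis by (simp flip: y_def)
  qed
next
  case (Suc a)
  define G where "G a i = exp (- l * (of_int i + 2 * R)) * \<Lambda> N ^ a *
      (1 - ((of_int i + R - \<mu> N * real a)\<^sup>2 + v N * real a) / R\<^sup>2)" for a i
  have m0: "m0 N \<ge> 0" using p unfolding m0_def w_def by (intro sum_nonneg) auto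
  then have L: "\<Lambda> N > 0" using b by (simp add: \<Lambda>_def add_pos_nonneg)
  define y where "y = of_int i + R - \<mu> N * real a"
  define E where "E = exp (- l * (of_int i + 2 * R)) * \<Lambda> N ^ a"
  have shift: "p * (1 - p) ^ k * G a (i - 1 + int k) =
      E * (w k * (1 - ((y - (1 - real k))\<^sup>2 + v N * real a) / R\<^sup>2))" for k
  proof -
    have "exp (- l * (of_int (i - 1 + int k) + 2 * R)) =
        exp (- l * (of_int i + 2 * R)) * exp (l * (1 - real k))"
      by (simp add: algebra_simps flip: exp_add)
    moreover have "of_int (i - 1 + int k) + R - \<mu> N * real a = y - (1 - real k)"
      by (simp add: y_def)
    ultimately show ?thesis unfolding G_def E_def w_def by (simp only: mult_ac)
  qed
  have quad: "(\<Sum>k<N. w k * (1 - ((y - (1 - real k))\<^sup>2 + v N * real a) / R\<^sup>2)) =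
      m0 N - (m0 N * y\<^sup>2 - 2 * y * m1 N + m2 N + m0 N * v N * real a) / R\<^sup>2"
  proof -
    have "w k * (1 - ((y - (1 - real k))\<^sup>2 + v N * real a) / R\<^sup>2) =
      w k - (w k * y\<^sup>2 - 2 * y * (w k * (1 - real k)) + w k * (1 - real k)\<^sup>2 + w k * (v N * real a)) / R\<^sup>2"
      for k
      using R by (simp add: field_simps power2_eq_square)
    then show ?thesis
      unfolding m0_def m1_def m2_def
      by (simp add: sum_subtractf sum.distrib sum_distrib_left sum_distrib_right mult.assoc
          flip: sum_divide_distrib)
  qed
  \<comment> \<open>\<open>\<mu> N\<close> and \<open>v N\<close> are the mean and variance of an
    increment that is 0 with probability \<open>1 / \<Lambda> N\<close> and \<open>1 - k\<close>
    with probability \<open>b * w k / \<Lambda> N\<close>. This choice makes the solution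
    exact.\<close>
  have bm1: "b * m1 N = \<mu> N * \<Lambda> N" and bm2: "b * m2 N = (v N + (\<mu> N)\<^sup>2) * \<Lambda> N"
    using L by (simp_all add: \<mu>_def v_def)
  have "G (Suc a) i = E * \<Lambda> N * (1 - ((y - \<mu> N)\<^sup>2 + v N * (real a + 1)) / R\<^sup>2)"
  proof -
    have "of_int i + R - \<mu> N * real (Suc a) = y - \<mu> N" by (simp add: y_def algebra_simps)
    then show ?thesis unfolding G_def E_def by (simp add: algebra_simps)
  qed
  also have "\<dots> = E * (\<Lambda> N - (\<Lambda> N * (y\<^sup>2 + v N * real a) - 2 * y * (\<mu> N * \<Lambda> N) + (v N + (\<mu> N)\<^sup>2) * \<Lambda> N) / R\<^sup>2)"
    using R by (simp add: field_simps power2_eq_square)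
  also have "\<dots> = E * (\<Lambda> N - (\<Lambda> N * (y\<^sup>2 + v N * real a) - 2 * y * (b * m1 N) + b * m2 N) / R\<^sup>2)"
    by (simp add: bm1 bm2)
  also have "\<dots> = E * (1 - (y\<^sup>2 + v N * real a) / R\<^sup>2) + b * (E *
      (m0 N - (m0 N * y\<^sup>2 - 2 * y * m1 N + m2 N + m0 N * v N * real a) / R\<^sup>2))"
    using R by (simp add: \<Lambda>_def field_simps)
  also have "\<dots> = G a i + b * (\<Sum>k<N. p * (1 - p) ^ k * G a (i - 1 + int k))"
    unfolding shift quad[symmetric] sum_distrib_left[symmetric] by (simp add: G_def E_def y_def)
  also have "\<dots> \<le> front p N b a i + b * (\<Sum>k<N. p * (1 - p) ^ k * front p N b a (i - 1 + int k))"
    using Suc[folded G_def] p b by (intro add_mono mult_left_mono sum_mono) auto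
  finally show ?case by (simp add: G_def)
qed


text \<open>A round has logarithmic length \<open>d\<close>, of which the factor
  \<open>1 - \<eta>\<close> is kept to leave room for the Chernoff bound. For small
  \<open>\<eta>\<close> and \<open>d\<close> the tilted walk still has speed above \<open>c\<close>
  per unit of logarithmic time, and the growth \<open>\<Lambda> ^ r\<close> beats the tilting
  factor, so the bound of \<open>front_ge\<close> grows exponentially in \<open>r\<close>.\<close>

lemma front_reaches:
  assumes p: "0 < p" "p < 1" and c: "0 < c" "c < cL p"
  obtains \<eta> d N r j where "0 < \<eta>" "\<eta> < 1" "0 < d" "0 < r" "0 < j"
    "c * (real r * d) \<le> real j" "2 \<le> front p N ((1 - \<eta>) * d) r (int j)"
proof -
  obtain z where z: "1 < z" "c < slope p z" "slope p z * ln z < growth p z"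
    using slope_approx[OF p c(2)] .
  define l where "l = ln z"
  have l: "0 < l" "z = exp l" using z by (simp_all add: l_def)
  define w where "w k = p * (1 - p) ^ k * exp (l * (1 - real k))" for k
  have w: "w k = p * (1 - p) ^ k * (z / z ^ k)" for k
    by (simp add: w_def l(2) right_diff_distrib exp_diff mult.commute[of l] exp_of_nat_mult)
  define m0 m1 m2 where "m0 N = (\<Sum>k<N. w k)" and "m1 N = (\<Sum>k<N. w k * (1 - real k))"
    and "m2 N = (\<Sum>k<N. w k * (1 - real k)\<^sup>2)" for N
  have lim: "m0 \<longlonglongrightarrow> growth p z" "m1 \<longlonglongrightarrow> slope p z"
    using partial_growth_slope[OF p z(1)] by (simp_all add: m0_def[abs_def] m1_def[abs_def] w)
  have "eventually (\<lambda>N. m1 N > c) sequentially" using lim(2) z(2) by (simp add: order_tendsto_iff)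
  moreover have "(\<lambda>N. m0 N - m1 N * l) \<longlonglongrightarrow> growth p z - slope p z * l"
    by (intro tendsto_intros lim)
  then have "eventually (\<lambda>N. m0 N - m1 N * l > 0) sequentially"
    by (rule order_tendstoD) (use z(3) in \<open>simp add: l_def\<close>)
  ultimately have "eventually (\<lambda>N. m1 N > c \<and> m0 N - m1 N * l > 0) sequentially"
    by eventually_elim auto
  then obtain N where N: "m1 N > c" "m0 N > m1 N * l"
    using eventually_happens'[OF sequentially_bot] by force
  have m0: "m0 N > 0" using N c l mult_pos_pos[of "m1 N" l] by linarith
  \<comment> \<open>Half of the relative gap between \<open>m1 N\<close> and
    \<open>c\<close>.\<close>
  define \<eta> where "\<eta> = (1 - c / m1 N) / 2"
  have eta: "0 < \<eta>" "\<eta> < 1" using N c divide_pos_pos[of c "m1 N"] by (simp_all add: \<eta>_def field_simps)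
  have eta1: "(1 - \<eta>) * m1 N > c" using N c by (simp add: \<eta>_def field_simps)
  \<comment> \<open>Solves \<open>c * (1 + d * m0 N) = (1 - \<eta>) * m1 N\<close>. As
    \<open>\<Lambda>\<close> is smaller than \<open>1 + d * m0 N\<close>, the drift
    \<open>\<mu>\<close> of a round then exceeds \<open>c * d\<close>.\<close>
  define d where "d = ((1 - \<eta>) * m1 N / c - 1) / m0 N"
  have d: "0 < d" using eta1 c m0 by (simp add: d_def field_simps)
  define b where "b = (1 - \<eta>) * d"
  have b: "0 < b" using eta d by (simp add: b_def)
  define \<Lambda> where "\<Lambda> = 1 + b * m0 N"
  have L: "1 < \<Lambda>" using b m0 by (simp add: \<Lambda>_def)
  define \<mu> where "\<mu> = b * m1 N / \<Lambda>"
  define v where "v = b * m2 N / \<Lambda> - \<mu>\<^sup>2"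
  have "c * \<Lambda> < c * (1 + d * m0 N)" using eta d m0 c by (simp add: \<Lambda>_def b_def)
  also have "\<dots> = (1 - \<eta>) * m1 N" using c m0 by (simp add: d_def)
  finally have "d * (c * \<Lambda>) < d * ((1 - \<eta>) * m1 N)" using d by simp
  then have "c * d < \<mu>" using L by (simp add: \<mu>_def b_def pos_less_divide_eq mult_ac)
  have "l * \<mu> < b * m0 N / \<Lambda>" using N b L by (simp add: \<mu>_def field_simps)
  also have "\<dots> \<le> ln \<Lambda>" using ln_add1_ge[of "b * m0 N"] b m0 by (simp add: \<Lambda>_def add.commute)
  finally have gap: "l * \<mu> < ln \<Lambda>" .
  \<comment> \<open>The first bound keeps the speed at least \<open>c\<close> after losing
    \<open>\<epsilon>\<close> per round; the second spends at most half of the gap between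
    \<open>ln \<Lambda>\<close> and \<open>l * \<mu>\<close>.\<close>
  define \<epsilon> where "\<epsilon> = min (\<mu> - c * d) ((ln \<Lambda> - l * \<mu>) / (2 * l))"
  have eps: "0 < \<epsilon>" "\<epsilon> \<le> \<mu> - c * d" using \<open>c * d < \<mu>\<close> gap l by (simp_all add: \<epsilon>_def)
  define \<kappa> where "\<kappa> = ln \<Lambda> - l * (\<mu> + \<epsilon>)"
  have "l * \<epsilon> \<le> (ln \<Lambda> - l * \<mu>) / 2"
    using mult_left_mono[of \<epsilon> "(ln \<Lambda> - l * \<mu>) / (2 * l)" l] l by (simp add: \<epsilon>_def)
  then have kap: "0 < \<kappa>" using gap by (simp add: \<kappa>_def algebra_simps)
  have "eventually (\<lambda>r. (1 + v * real r) / (\<epsilon> * real r)\<^sup>2 \<le> 1/2) sequentially"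
    using eps(1) by real_asymp
  moreover have "eventually (\<lambda>r. 4 \<le> exp (\<kappa> * real r - l)) sequentially"
    using kap by real_asymp
  ultimately have "eventually (\<lambda>r. 0 < r \<and> (1 + v * real r) / (\<epsilon> * real r)\<^sup>2 \<le> 1/2 \<and>
      4 \<le> exp (\<kappa> * real r - l)) sequentially"
    using eventually_gt_at_top[of 0] by eventually_elim auto
  then obtain r where r: "0 < r" "(1 + v * real r) / (\<epsilon> * real r)\<^sup>2 \<le> 1/2"
    "4 \<le> exp (\<kappa> * real r - l)"
    using eventually_happens'[OF sequentially_bot] by force
  define j where "j = nat \<lceil>(\<mu> - \<epsilon>) * real r\<rceil>"
  have "0 < c * d * real r" using c d r by simp
  also have "c * d * real r \<le> (\<mu> - \<epsilon>) * real r" using eps by (intro mult_right_mono) auto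
  finally have x: "0 < (\<mu> - \<epsilon>) * real r" "c * d * real r \<le> (\<mu> - \<epsilon>) * real r"
    using \<open>c * d * real r \<le> (\<mu> - \<epsilon>) * real r\<close> by auto
  have j: "(\<mu> - \<epsilon>) * real r \<le> real j" "real j \<le> (\<mu> - \<epsilon>) * real r + 1"
    using x(1) unfolding j_def by linarith+
  \<comment> \<open>With this radius the centred position \<open>j + R - \<mu> * r\<close> lies in
    [0, 1], so only the variance term \<open>v * r\<close> matters against
    \<open>R\<^sup>2\<close>.\<close>
  define R where "R = \<epsilon> * real r"
  have R: "0 < R" using eps r by (simp add: R_def)
  have "exp (- l * (of_int (int j) + 2 * R)) * \<Lambda> ^ r *
      (1 - ((of_int (int j) + R - \<mu> * real r)\<^sup>2 + v * real r) / R\<^sup>2) \<le> front p N b r (int j)"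
    using front_ge[OF p b l(1) R, of "int j" N r]
    unfolding v_def \<mu>_def \<Lambda>_def m0_def m1_def m2_def w_def by simp
  moreover have "2 \<le> exp (- l * (of_int (int j) + 2 * R)) * \<Lambda> ^ r *
      (1 - ((of_int (int j) + R - \<mu> * real r)\<^sup>2 + v * real r) / R\<^sup>2)"
  proof -
    have "4 * (1/2) \<le> exp (- l * (of_int (int j) + 2 * R)) * \<Lambda> ^ r *
      (1 - ((of_int (int j) + R - \<mu> * real r)\<^sup>2 + v * real r) / R\<^sup>2)"
    proof (rule mult_mono)
      have "real j + 2 * R \<le> (\<mu> + \<epsilon>) * real r + 1" using j(2) by (simp add: R_def algebra_simps)
      then have "l * (real j + 2 * R) \<le> l * ((\<mu> + \<epsilon>) * real r + 1)"
        using l by (intro mult_left_mono) auto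
      then have "\<kappa> * real r - l \<le> - l * (real j + 2 * R) + real r * ln \<Lambda>"
        by (simp add: \<kappa>_def algebra_simps)
      then have "exp (\<kappa> * real r - l) \<le> exp (- l * (real j + 2 * R)) * exp (real r * ln \<Lambda>)"
        by (simp flip: exp_add)
      also have "exp (real r * ln \<Lambda>) = \<Lambda> ^ r" using L by (simp add: exp_of_nat_mult)
      finally show "4 \<le> exp (- l * (of_int (int j) + 2 * R)) * \<Lambda> ^ r" using r by simp
      have "\<bar>of_int (int j) + R - \<mu> * real r\<bar> \<le> \<bar>1\<bar>"
        using j by (simp add: R_def algebra_simps abs_le_iff)
      then have "(of_int (int j) + R - \<mu> * real r)\<^sup>2 \<le> 1\<^sup>2" by (simp only: abs_le_square_iff)
      then have "((of_int (int j) + R - \<mu> * real r)\<^sup>2 + v * real r) / R\<^sup>2 \<le> (1 + v * real r) / R\<^sup>2"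
        by (intro divide_right_mono) auto
      then show "1/2 \<le> 1 - ((of_int (int j) + R - \<mu> * real r)\<^sup>2 + v * real r) / R\<^sup>2"
        using r(2)[folded R_def] by linarith
    qed (use L in auto)
    then show ?thesis by simp
  qed
  ultimately have "2 \<le> front p N b r (int j)" by linarith
  moreover have "c * (real r * d) \<le> real j" using x j by (simp add: algebra_simps)
  moreover have "0 < j" using x j by linarith
  ultimately show ?thesis using that eta d r by (simp add: b_def)
qed

subsection \<open>Depths and distances in a fixed tree\<close>

text \<open>The condition concerns all \<open>v\<close>, including vertices not yet born: the
  constant function 0 satisfies it, and each step preserves it.\<close>

definition surfer_state :: "(nat \<Rightarrow> nat) \<Rightarrow> bool" where
  "surfer_state f \<longleftrightarrow> f 0 = 0 \<and> (\<forall>v>0. f v < v)"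

definition depth :: "(nat \<Rightarrow> nat) \<Rightarrow> nat \<Rightarrow> nat" where
  "depth f v = (LEAST k. (f ^^ k) v = 0)"

definition below1 :: "(nat \<Rightarrow> nat) \<Rightarrow> nat \<Rightarrow> bool" where
  "below1 f v \<longleftrightarrow> (\<exists>k. (f ^^ k) v = 1)"

context
  fixes f :: "nat \<Rightarrow> nat"
  assumes st: "surfer_state f"
begin

lemma surfer_0: "f 0 = 0" and surfer_less: "v > 0 \<Longrightarrow> f v < v"
  using st by (auto simp: surfer_state_def)

lemma surfer_1: "f (Suc 0) = 0"
  using surfer_less[of "Suc 0"] by simp

lemma surfer_le: "f v \<le> v"
  using surfer_0 surfer_less[of v] by (cases "v = 0") auto

lemma funpow_0: "(f ^^ k) 0 = 0"
  by (induction k) (auto simp: surfer_0)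

lemma funpow_le: "(f ^^ k) v \<le> v"
proof (induction k)
  case (Suc k)
  then show ?case using surfer_le[of "(f ^^ k) v"] by simp
qed auto

text \<open>Each step lowers a nonzero label, so the root is reached and the \<open>LEAST\<close> in
  \<open>depth\<close> is attained.\<close>

lemma funpow_eq_0: "(f ^^ v) v = 0"
proof -
  have "(f ^^ k) v \<le> v - k" for k
  proof (induction k)
    case (Suc k)
    then show ?case using surfer_less[of "(f ^^ k) v"] surfer_0 by (cases "(f ^^ k) v = 0") auto
  qed auto
  from this[of v] show ?thesis by simp
qed

lemma depth_0: "depth f 0 = 0"
  by (simp add: depth_def)

lemma depth_pos: "v > 0 \<Longrightarrow> depth f v = Suc (depth f (f v))"
proof -
  assume "v > 0"
  then have "depth f v = Suc (LEAST k. (f ^^ Suc k) v = 0)"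
    unfolding depth_def by (intro Least_Suc[where n = v]) (auto simp: funpow_eq_0)
  then show ?thesis by (simp add: depth_def funpow_Suc_right del: funpow.simps)
qed

text \<open>Truncated subtraction on \<open>nat\<close> is the reflection: the self-loop holds the
  walk at the root.\<close>

lemma depth_funpow: "depth f ((f ^^ k) v) = depth f v - k"
proof (induction k)
  case (Suc k)
  show ?case
  proof (cases "(f ^^ k) v = 0")
    case False
    then show ?thesis using Suc depth_pos[of "(f ^^ k) v"] by simp
  qed (use Suc in \<open>auto simp: surfer_0 depth_0\<close>)
qed auto

lemma below1_0: "\<not> below1 f 0" and below1_1: "below1 f (Suc 0)"
  unfolding below1_def by (simp add: funpow_0) (rule exI[of _ 0], simp)

lemma below1_step: "v \<noteq> Suc 0 \<Longrightarrow> below1 f v \<longleftrightarrow> below1 f (f v)"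
proof
  assume "v \<noteq> Suc 0" "below1 f v"
  then obtain k where "(f ^^ k) v = 1" by (auto simp: below1_def)
  with \<open>v \<noteq> Suc 0\<close> show "below1 f (f v)"
    unfolding below1_def by (cases k) (auto simp: funpow_swap1)
next
  assume "below1 f (f v)"
  then show "below1 f v" unfolding below1_def by (metis comp_apply funpow_Suc_right)
qed

text \<open>A walk leaves its class only by entering the root: the single exit from the subtree of
  vertex 1 is the step from 1, which has depth 1, to 0.\<close>

lemma below1_funpow: "k < depth f v \<Longrightarrow> below1 f ((f ^^ k) v) = below1 f v"
proof (induction k)
  case (Suc k)
  have "(f ^^ k) v \<noteq> Suc 0"
  proof
    assume "(f ^^ k) v = Suc 0"
    then have "depth f v - k = 1" using depth_funpow[of k v] depth_pos[of "Suc 0"] surfer_less[of "Suc 0"]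
      by (simp add: depth_0)
    then show False using Suc.prems by simp
  qed
  then show ?case using Suc below1_step[of "(f ^^ k) v"] by simp
qed auto

end

section \<open>Effect of attaching one vertex\<close>

context
  fixes f :: "nat \<Rightarrow> nat" and s y :: nat
  assumes st: "surfer_state f" and s: "y < s"
begin

lemma surfer_state_upd: "surfer_state (f(s := y))"
  using st s by (auto simp: surfer_state_def)

text \<open>Walks never increase the label, so a walk started below \<open>s\<close> does not read
  the new value at \<open>s\<close>.\<close>

lemma funpow_upd: "v < s \<Longrightarrow> ((f(s := y)) ^^ k) v = (f ^^ k) v"
proof (induction k)
  case (Suc k)
  then show ?case using funpow_le[OF st, of k v] by auto
qed auto

lemma depth_upd: "v < s \<Longrightarrow> depth (f(s := y)) v = depth f v"
  by (simp add: depth_def funpow_upd)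

lemma below1_upd: "v < s \<Longrightarrow> below1 (f(s := y)) v = below1 f v"
  by (simp add: below1_def funpow_upd)

lemma depth_new: "depth (f(s := y)) s = Suc (depth f y)"
  using depth_pos[OF surfer_state_upd, of s] s by (simp add: depth_upd)

lemma below1_new: "s \<noteq> 1 \<Longrightarrow> below1 (f(s := y)) s = below1 f y"
  using below1_step[OF surfer_state_upd, of s] s by (simp add: below1_upd)

end

text \<open>Levels are integers so that they can be shifted by negative relative levels. For
  \<open>h \<ge> 1\<close> the root does not count towards the class \<open>False\<close>.\<close>

definition deep :: "bool \<Rightarrow> (nat \<Rightarrow> nat) \<Rightarrow> int \<Rightarrow> nat \<Rightarrow> bool" where
  "deep i f h v \<longleftrightarrow> h \<le> int (depth f v) \<and> below1 f v = i"

definition deep_count :: "bool \<Rightarrow> (nat \<Rightarrow> nat) \<Rightarrow> nat \<Rightarrow> int \<Rightarrow> nat" where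
  "deep_count i f t h = card {v. v < t \<and> deep i f h v}"

text \<open>Because \<open>h \<ge> 2\<close>, the depth of \<open>u\<close> exceeds
  \<open>k\<close>: the walk stops before the root, hence in the class of \<open>u\<close>, at depth
  at least \<open>h - 1\<close>. It also follows that \<open>u\<close> is not the root, so
  \<open>s\<close> is not 1.\<close>

lemma deep_new:
  assumes st: "surfer_state f" and "u < s" "2 \<le> h" "deep i f (h - 1 + int k) u"
  shows "deep i (f(s := (f ^^ k) u)) h s"
proof -
  have y: "(f ^^ k) u < s" using funpow_le[OF st, of k u] \<open>u < s\<close> by simp
  have "s \<noteq> 1" using assms by (auto simp: deep_def depth_0)
  have "int k < int (depth f u)" using assms by (auto simp: deep_def)
  then show ?thesis
    using assms depth_new[OF st y] below1_new[OF st y \<open>s \<noteq> 1\<close>]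
      depth_funpow[OF st, of k u] below1_funpow[OF st, of k u]
    by (auto simp: deep_def)
qed

lemma deep_count_Suc:
  assumes st: "surfer_state f" and y: "y < s"
  shows "deep_count i (f(s := y)) (Suc s) h = deep_count i f s h + (if deep i (f(s := y)) h s then 1 else 0)"
proof -
  have "{v. v < Suc s \<and> deep i (f(s := y)) h v} =
      {v. v < s \<and> deep i f h v} \<union> (if deep i (f(s := y)) h s then {s} else {})"
    using depth_upd[OF st y] below1_upd[OF st y] by (auto simp: deep_def less_Suc_eq)
  then show ?thesis unfolding deep_count_def by (auto simp: card_insert_if)
qed

lemma deep_count_antimono: "h \<le> h' \<Longrightarrow> deep_count i f t h' \<le> deep_count i f t h"
  unfolding deep_count_def by (intro card_mono) (auto simp: deep_def)

section \<open>Undirected paths and the diameter\<close>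

lemma sym_relpow: "sym r \<Longrightarrow> (a, b) \<in> r ^^ k \<Longrightarrow> (b, a) \<in> r ^^ k"
proof (induction k arbitrary: b)
  case (Suc k)
  then obtain c where "(a, c) \<in> r ^^ k" "(c, b) \<in> r" by auto
  then show ?case using Suc by (intro relpow_Suc_I2[of b c]) (auto dest: symD)
qed auto

context
  fixes f :: "nat \<Rightarrow> nat" and n :: nat
  assumes st: "surfer_state f"
begin

lemma edges_path_to_root: "v < n \<Longrightarrow> (v, 0) \<in> rs_edges f n ^^ depth f v"
proof (induction v rule: less_induct)
  case (less v)
  show ?case
  proof (cases "v = 0")
    case False
    then have "f v < v" using surfer_less[OF st] by simp
    then have "(f v, 0) \<in> rs_edges f n ^^ depth f (f v)" using less by simp
    moreover have "(v, f v) \<in> rs_edges f n" using \<open>f v < v\<close> less.prems by (auto simp: rs_edges_def)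
    ultimately have "(v, 0) \<in> rs_edges f n ^^ Suc (depth f (f v))" by (rule relpow_Suc_I2[rotated])
    then show ?thesis using False depth_pos[OF st, of v] by simp
  qed (use st in \<open>simp add: depth_0\<close>)
qed

lemma edges_path: "a < n \<Longrightarrow> b < n \<Longrightarrow> (a, b) \<in> rs_edges f n ^^ (depth f a + depth f b)"
proof -
  assume "a < n" "b < n"
  moreover have "sym (rs_edges f n)" by (auto simp: sym_def rs_edges_def)
  ultimately have "(a, 0) \<in> rs_edges f n ^^ depth f a" "(0, b) \<in> rs_edges f n ^^ depth f b"
    using edges_path_to_root by (auto intro: sym_relpow)
  then show ?thesis unfolding relpow_add by (rule relcompI)
qed

lemma rs_dist_le: "a < n \<Longrightarrow> b < n \<Longrightarrow> rs_dist f n a b \<le> depth f a + depth f b"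
  unfolding rs_dist_def using edges_path by (intro Least_le)

text \<open>The root distance, counted negatively below vertex 1, changes by one along every edge.\<close>

lemma rs_dist_ge:
  assumes "a < n" "b < n" "below1 f a" "\<not> below1 f b"
  shows "depth f a + depth f b \<le> rs_dist f n a b"
proof -
  define \<phi> where "\<phi> v = (if below1 f v then - int (depth f v) else int (depth f v))" for v
  \<comment> \<open>The sign switches only across the edge between 1 and the root, where the values
    are -1 and 0.\<close>
  have par: "\<bar>\<phi> v - \<phi> (f v)\<bar> \<le> 1" if "v > 0" for v
    using that depth_pos[OF st, of v] below1_step[OF st, of v] st
    by (cases "v = 1") (auto simp: \<phi>_def surfer_1 depth_0)
  have "\<bar>\<phi> u - \<phi> v\<bar> \<le> int k" if "(u, v) \<in> rs_edges f n ^^ k" for k u v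
    using that
  proof (induction k arbitrary: v)
    case (Suc k)
    then obtain w where "(u, w) \<in> rs_edges f n ^^ k" "(w, v) \<in> rs_edges f n" by auto
    moreover from this have "\<bar>\<phi> w - \<phi> v\<bar> \<le> 1"
      using par[of w] par[of v] by (auto simp: rs_edges_def abs_minus_commute)
    ultimately show ?case using Suc.IH[of w] by simp
  qed auto
  moreover have "(a, b) \<in> rs_edges f n ^^ rs_dist f n a b"
    unfolding rs_dist_def using edges_path[OF assms(1,2)] by (rule LeastI)
  ultimately have "\<bar>\<phi> a - \<phi> b\<bar> \<le> int (rs_dist f n a b)" by blast
  then show ?thesis using assms by (simp add: \<phi>_def)
qed

lemma finite_dists: "finite {rs_dist f n a b | a b. a < n \<and> b < n}"
proof -
  have "{rs_dist f n a b | a b. a < n \<and> b < n} = (\<lambda>(a, b). rs_dist f n a b) ` ({..<n} \<times> {..<n})"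
    by auto
  then show ?thesis by simp
qed

lemma rs_diam_le:
  assumes "n > 0" and "\<And>v. v < n \<Longrightarrow> depth f v \<le> h"
  shows "rs_diam f n \<le> 2 * h"
  unfolding rs_diam_def
proof (rule Max.boundedI)
  fix x assume "x \<in> {rs_dist f n a b | a b. a < n \<and> b < n}"
  then obtain a b where "x = rs_dist f n a b" "a < n" "b < n" by auto
  then show "x \<le> 2 * h" using rs_dist_le[of a b] assms(2)[of a] assms(2)[of b] by simp
qed (use finite_dists assms in auto)

lemma rs_diam_ge:
  assumes "0 < deep_count True f n (int h)" "0 < deep_count False f n (int h)"
  shows "2 * h \<le> rs_diam f n"
proof -
  obtain a b where ab: "a < n" "b < n" "deep True f (int h) a" "deep False f (int h) b"
    using assms by (auto simp: deep_count_def card_gt_0_iff)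
  then have "2 * h \<le> rs_dist f n a b" using rs_dist_ge[of a b] by (simp add: deep_def)
  also have "\<dots> \<le> rs_diam f n"
    unfolding rs_diam_def using ab by (intro Max_ge finite_dists) auto
  finally show ?thesis .
qed

end

subsection \<open>The random tree and a Chernoff bound\<close>

lemma expectation_mono_finite:
  fixes g h :: "'a \<Rightarrow> real"
  assumes "finite (set_pmf M)" "\<And>x. x \<in> set_pmf M \<Longrightarrow> g x \<le> h x"
  shows "measure_pmf.expectation M g \<le> measure_pmf.expectation M h"
  using assms by (intro integral_mono_AE integrable_measure_pmf_finite) (auto simp: AE_measure_pmf_iff)

lemma expectation_bind_finite:
  fixes h :: "'b \<Rightarrow> real"
  assumes "finite (set_pmf M)" "\<And>x. x \<in> set_pmf M \<Longrightarrow> finite (set_pmf (N x))"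
  shows "measure_pmf.expectation (bind_pmf M N) h =
    measure_pmf.expectation M (\<lambda>x. measure_pmf.expectation (N x) h)"
  using assms by (subst pmf_expectation_bind[of "set_pmf M"]) (auto simp: integral_measure_pmf[of "set_pmf M"])

lemma prob_eq_expectation: "measure_pmf.prob M A = measure_pmf.expectation M (indicat_real A)"
  by simp

lemma rs_step_map:
  "rs_step p s f = pmf_of_set {..<s} \<bind> (\<lambda>u. map_pmf (\<lambda>X. f(s := (f ^^ X) u)) (geometric_pmf p))"
  by (simp add: rs_step_def map_pmf_def)

lemma set_rs_step:
  assumes "0 < s" "f' \<in> set_pmf (rs_step p s f)"
  obtains u k where "u < s" "f' = f(s := (f ^^ k) u)"
  using assms by (auto simp: rs_step_map set_pmf_of_set lessThan_empty_iff)

text \<open>Walk lengths are unbounded, but the walk ends in a label at most \<open>u\<close>. The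
  laws of trees thus have finite support, and expectations over them raise no integrability
  questions.\<close>

lemma finite_map_surfer:
  assumes "surfer_state f"
  shows "finite (set_pmf (map_pmf (\<lambda>X. f(s := (f ^^ X) u)) P))"
proof (rule finite_subset)
  show "set_pmf (map_pmf (\<lambda>X. f(s := (f ^^ X) u)) P) \<subseteq> (\<lambda>y. f(s := y)) ` {..u}"
    using funpow_le[OF assms] by auto
qed auto

lemma finite_set_rs_step:
  assumes "surfer_state f" "0 < s"
  shows "finite (set_pmf (rs_step p s f))"
  using assms finite_map_surfer[OF assms(1)] unfolding rs_step_map set_bind_pmf
  by (intro finite_UN_I) (auto simp: set_pmf_of_set lessThan_empty_iff)

lemma surfer_state_rs_step:
  assumes "surfer_state f" "0 < s" "f' \<in> set_pmf (rs_step p s f)"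
  shows "surfer_state f'"
proof -
  obtain u k where "u < s" "f' = f(s := (f ^^ k) u)" using set_rs_step assms by metis
  then show ?thesis using assms(1) funpow_le[OF assms(1), of k u] by (auto intro!: surfer_state_upd)
qed

lemma expectation_rs_step:
  fixes h :: "(nat \<Rightarrow> nat) \<Rightarrow> real"
  assumes "surfer_state f" "0 < s"
  shows "measure_pmf.expectation (rs_step p s f) h =
    (\<Sum>u<s. measure_pmf.expectation (geometric_pmf p) (\<lambda>X. h (f(s := (f ^^ X) u)))) / real s"
  unfolding rs_step_map using assms finite_map_surfer[OF assms(1)]
  by (subst pmf_expectation_bind_pmf_of_set)
    (auto simp: lessThan_empty_iff sum_divide_distrib field_simps)

lemma prob_rs_step:
  assumes "surfer_state f" "0 < s"
  shows "measure_pmf.prob (rs_step p s f) A =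
    (\<Sum>u<s. measure_pmf.prob (geometric_pmf p) {X. f(s := (f ^^ X) u) \<in> A}) / real s"
proof -
  have "indicat_real A (f(s := (f ^^ X) u)) = indicat_real {X. f(s := (f ^^ X) u) \<in> A} X" for X u
    by (simp add: indicator_def)
  then show ?thesis
    unfolding prob_eq_expectation[of "rs_step p s f"] expectation_rs_step[OF assms] by simp
qed

section \<open>Continuing the process from a given tree\<close>

fun rs_run :: "real \<Rightarrow> nat \<Rightarrow> nat \<Rightarrow> (nat \<Rightarrow> nat) \<Rightarrow> (nat \<Rightarrow> nat) pmf" where
  "rs_run p t 0 f = return_pmf f"
| "rs_run p t (Suc m) f = bind_pmf (rs_run p t m f) (rs_step p (t + m))"

lemma rs_tree_Suc: "0 < n \<Longrightarrow> rs_tree p (Suc n) = bind_pmf (rs_tree p n) (rs_step p n)"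
  by (cases n) auto

lemma rs_tree_add: "0 < t \<Longrightarrow> rs_tree p (t + m) = bind_pmf (rs_tree p t) (rs_run p t m)"
proof (induction m)
  case 0
  have "rs_run p t 0 = return_pmf" by (rule ext) simp
  then show ?case by (simp add: bind_return_pmf')
next
  case (Suc m)
  have "rs_run p t (Suc m) = (\<lambda>f. rs_run p t m f \<bind> rs_step p (t + m))" by (rule ext) simp
  then show ?case using Suc by (simp add: bind_assoc_pmf rs_tree_Suc)
qed

lemma rs_run_set:
  assumes "surfer_state f" "0 < t"
  shows "finite (set_pmf (rs_run p t m f))"
    and "f' \<in> set_pmf (rs_run p t m f) \<Longrightarrow> surfer_state f' \<and>
      deep_count i f t h \<le> deep_count i f' (t + m) h"
proof -
  have "finite (set_pmf (rs_run p t m f)) \<and> (\<forall>f' \<in> set_pmf (rs_run p t m f). surfer_state f' \<and>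
      (\<forall>i h. deep_count i f t h \<le> deep_count i f' (t + m) h))"
  proof (induction m)
    case (Suc m)
    then have "finite (set_pmf (rs_run p t (Suc m) f))"
      using finite_set_rs_step assms by (auto simp: set_bind_pmf)
    moreover have "surfer_state f' \<and> (\<forall>i h. deep_count i f t h \<le> deep_count i f' (t + Suc m) h)"
      if f': "f' \<in> set_pmf (rs_run p t (Suc m) f)" for f'
    proof -
      obtain g where g: "g \<in> set_pmf (rs_run p t m f)" "f' \<in> set_pmf (rs_step p (t + m) g)"
        using f' by (auto simp: set_bind_pmf)
      have sg: "surfer_state g" using Suc g by auto
      obtain u k where uk: "u < t + m" "f' = g(t + m := (g ^^ k) u)"
        using set_rs_step[OF _ g(2)] assms by auto
      have "(g ^^ k) u < t + m" using funpow_le[OF sg, of k u] uk by simp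
      then have "deep_count i g (t + m) h \<le> deep_count i f' (t + Suc m) h" for i h
        using deep_count_Suc[OF sg, of _ "t + m"] uk by simp
      moreover have "surfer_state f'" using surfer_state_rs_step[OF sg _ g(2)] assms by simp
      moreover have "deep_count i f t h \<le> deep_count i g (t + m) h" for i h using Suc g by auto
      ultimately show ?thesis by (meson order_trans)
    qed
    ultimately show ?case by blast
  qed (use assms in auto)
  then show "finite (set_pmf (rs_run p t m f))"
    and "f' \<in> set_pmf (rs_run p t m f) \<Longrightarrow> surfer_state f' \<and>
      deep_count i f t h \<le> deep_count i f' (t + m) h" by auto
qed

lemma rs_tree_set:
  assumes "0 < n"
  shows "finite (set_pmf (rs_tree p n))" and "f \<in> set_pmf (rs_tree p n) \<Longrightarrow> surfer_state f"
proof -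
  have "surfer_state (\<lambda>_. 0)" by (simp add: surfer_state_def)
  moreover have "rs_tree p n = rs_run p 1 (n - 1) (\<lambda>_. 0)"
    using rs_tree_add[of 1 p "n - 1"] assms by (simp add: bind_return_pmf)
  ultimately show "finite (set_pmf (rs_tree p n))"
    and "f \<in> set_pmf (rs_tree p n) \<Longrightarrow> surfer_state f"
    using rs_run_set by (metis zero_less_one)+
qed

text \<open>Conditioning on the tree at time \<open>t\<close>: either it lies in the bad set
  \<open>A\<close>, or the continuation reaches \<open>B\<close> with probability at most
  \<open>e\<close>.\<close>

lemma prob_rs_tree_add_le:
  assumes t: "0 < t" and e: "0 \<le> e"
    and run: "\<And>f. surfer_state f \<Longrightarrow> f \<notin> A \<Longrightarrow> measure_pmf.prob (rs_run p t m f) B \<le> e"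
  shows "measure_pmf.prob (rs_tree p (t + m)) B \<le> measure_pmf.prob (rs_tree p t) A + e"
proof -
  have "measure_pmf.prob (rs_tree p (t + m)) B =
      measure_pmf.expectation (rs_tree p t) (\<lambda>f. measure_pmf.prob (rs_run p t m f) B)"
    unfolding rs_tree_add[OF t] prob_eq_expectation
    using rs_tree_set[OF t] rs_run_set(1)[OF _ t] by (subst expectation_bind_finite) auto
  also have "\<dots> \<le> measure_pmf.expectation (rs_tree p t) (\<lambda>f. indicat_real A f + e)"
  proof (intro expectation_mono_finite rs_tree_set(1) t)
    show "measure_pmf.prob (rs_run p t m f) B \<le> indicat_real A f + e"
      if "f \<in> set_pmf (rs_tree p t)" for f
      using run[of f] rs_tree_set(2)[OF t that] e
        order_trans[OF measure_pmf.prob_le_1[of "rs_run p t m f" B], of "1 + e"]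
      by (cases "f \<in> A") auto
  qed
  also have "\<dots> = measure_pmf.prob (rs_tree p t) A + e"
    using rs_tree_set(1)[OF t] by (simp add: integrable_measure_pmf_finite)
  finally show ?thesis .
qed

text \<open>For a fixed start \<open>u\<close>, the walk lengths \<open>k < N\<close> with
  \<open>u\<close> at level at least \<open>h - 1 + k\<close> all make the new vertex deep. Summing
  their geometric weights over \<open>u\<close> and exchanging the sums gives the counts.\<close>

lemma prob_deep_new_ge:
  assumes p: "0 < p" "p < 1" and st: "surfer_state f" and s: "0 < s" and h: "2 \<le> h"
  shows "(\<Sum>k<N. p * (1 - p) ^ k * real (deep_count i f s (h - 1 + int k))) / real s
    \<le> measure_pmf.prob (rs_step p s f) {f'. deep i f' h s}"
proof -
  have dc: "real (deep_count i f s h) = (\<Sum>u<s. if deep i f h u then 1 else 0)" for h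
    by (simp add: deep_count_def sum.If_cases Int_def)
  have "(\<Sum>k<N. p * (1 - p) ^ k * real (deep_count i f s (h - 1 + int k))) =
      (\<Sum>u<s. \<Sum>k<N. p * (1 - p) ^ k * (if deep i f (h - 1 + int k) u then 1 else 0))"
    unfolding dc sum_distrib_left by (rule sum.swap)
  also have "\<dots> \<le> (\<Sum>u<s. measure_pmf.prob (geometric_pmf p) {X. f(s := (f ^^ X) u) \<in> {f'. deep i f' h s}})"
  proof (rule sum_mono)
    fix u assume u: "u \<in> {..<s}"
    define K where "K = {k \<in> {..<N}. deep i f (h - 1 + int k) u}"
    have "(\<Sum>k<N. p * (1 - p) ^ k * (if deep i f (h - 1 + int k) u then 1 else 0)) =
        (\<Sum>k<N. if deep i f (h - 1 + int k) u then pmf (geometric_pmf p) k else 0)"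
      using p by (intro sum.cong) auto
    also have "\<dots> = sum (pmf (geometric_pmf p)) K"
      unfolding K_def by (simp add: sum.If_cases Int_def)
    also have "\<dots> = measure_pmf.prob (geometric_pmf p) K"
      by (rule measure_measure_pmf_finite[symmetric]) (simp add: K_def)
    also have "\<dots> \<le> measure_pmf.prob (geometric_pmf p) {X. f(s := (f ^^ X) u) \<in> {f'. deep i f' h s}}"
      using deep_new[OF st _ h] u by (intro measure_pmf.finite_measure_mono) (auto simp: K_def)
    finally show "(\<Sum>k<N. p * (1 - p) ^ k * (if deep i f (h - 1 + int k) u then 1 else 0)) \<le> \<dots>" .
  qed
  finally show ?thesis unfolding prob_rs_step[OF st s] by (intro divide_right_mono) auto
qed

text \<open>A start at the root ends at the root whatever the walk length. This seeds the class
  \<open>False\<close> at level 1, which \<open>deep_new\<close> does not cover.\<close>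

lemma prob_attach_root_ge:
  assumes st: "surfer_state f" and s: "2 \<le> s"
  shows "1 / real s \<le> measure_pmf.prob (rs_step p s f) {f'. deep False f' 1 s}"
proof -
  have "deep False (f(s := 0)) 1 s"
    using depth_new[OF st, of 0 s] below1_new[OF st, of 0 s] below1_0[OF st] s by (simp add: deep_def)
  then have "{X. f(s := (f ^^ X) 0) \<in> {f'. deep False f' 1 s}} = UNIV" by (simp add: funpow_0[OF st])
  then have "1 \<le> (\<Sum>u\<in>{0}. measure_pmf.prob (geometric_pmf p) {X. f(s := (f ^^ X) u) \<in> {f'. deep False f' 1 s}})"
    by simp
  also have "\<dots> \<le> (\<Sum>u<s. measure_pmf.prob (geometric_pmf p) {X. f(s := (f ^^ X) u) \<in> {f'. deep False f' 1 s}})"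
    using s by (intro sum_mono2) auto
  finally show ?thesis using s by (subst prob_rs_step[OF st]) (auto intro: divide_right_mono)
qed

text \<open>Telescoping \<open>ln (1 + 1 / s) \<le> 1 / s\<close>; it turns success probabilities
  \<open>\<kappa> / s\<close> into logarithmic time.\<close>

lemma ln_ratio_le_harmonic:
  assumes "0 < t"
  shows "ln (real (t + m) / real t) \<le> (\<Sum>s\<in>{t..<t + m}. 1 / real s)"
proof (induction m)
  case (Suc m)
  have "real (t + Suc m) / real t = real (t + m) / real t * (1 + 1 / real (t + m))"
    using assms by (simp add: divide_simps)
  then have "ln (real (t + Suc m) / real t) = ln (real (t + m) / real t) + ln (1 + 1 / real (t + m))"
    by (simp only:) (intro ln_mult_pos, use assms in \<open>auto intro: add_pos_nonneg\<close>)
  also have "ln (1 + 1 / real (t + m)) \<le> 1 / real (t + m)" by (intro ln_add_one_self_le_self) auto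
  finally show ?case using Suc by simp
qed (use assms in simp)

text \<open>Each step multiplies the power by \<open>x\<close> with conditional probability at least
  \<open>\<kappa> / s\<close>, so the expectation shrinks by
  \<open>1 - (1 - x) * \<kappa> / s\<close> or more. The hypothesis \<open>new\<close> may assume
  that no count has dropped since time \<open>t\<close>, as counts never decrease along a
  run.\<close>

lemma expectation_count_power_le:
  assumes t: "0 < t" and st: "surfer_state f" and x: "0 < x" "x < 1" and \<kappa>: "0 \<le> \<kappa>"
    and new: "\<And>s f'. t \<le> s \<Longrightarrow> surfer_state f' \<Longrightarrow> (\<And>h'. deep_count i f t h' \<le> deep_count i f' s h') \<Longrightarrow>
      \<kappa> / real s \<le> measure_pmf.prob (rs_step p s f') {f''. deep i f'' h s}"
  shows "measure_pmf.expectation (rs_run p t m f) (\<lambda>f'. x ^ deep_count i f' (t + m) h) \<le>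
    x ^ deep_count i f t h * exp (- (1 - x) * \<kappa> * (\<Sum>s\<in>{t..<t + m}. 1 / real s))"
proof (induction m)
  case (Suc m)
  define s where "s = t + m"
  define S where "S = (\<Sum>s\<in>{t..<t + m}. 1 / real s)"
  have step: "measure_pmf.expectation (rs_step p s g) (\<lambda>f'. x ^ deep_count i f' (Suc s) h) \<le>
      x ^ deep_count i g s h * exp (- (1 - x) * \<kappa> * (1 / real s))"
    if g: "g \<in> set_pmf (rs_run p t m f)" for g
  proof -
    note sg = rs_run_set(2)[OF st t g]
    have sp: "0 < s" using t by (simp add: s_def)
    have "measure_pmf.expectation (rs_step p s g) (\<lambda>f'. x ^ deep_count i f' (Suc s) h) \<le>
        measure_pmf.expectation (rs_step p s g)
          (\<lambda>f'. x ^ deep_count i g s h * (1 - (1 - x) * indicat_real {f''. deep i f'' h s} f'))"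
    proof (intro expectation_mono_finite finite_set_rs_step sp)
      fix f' assume "f' \<in> set_pmf (rs_step p s g)"
      then obtain u k where "u < s" "f' = g(s := (g ^^ k) u)" using set_rs_step sp by metis
      moreover from this have "(g ^^ k) u < s" using sg funpow_le[of g k u] by simp
      ultimately show "x ^ deep_count i f' (Suc s) h \<le>
          x ^ deep_count i g s h * (1 - (1 - x) * indicat_real {f''. deep i f'' h s} f')"
        using sg deep_count_Suc[of g "(g ^^ k) u" s i h] by (auto simp: indicator_def)
    qed (use sg in blast)
    also have "\<dots> = x ^ deep_count i g s h *
        (1 - (1 - x) * measure_pmf.prob (rs_step p s g) {f''. deep i f'' h s})"
      using finite_set_rs_step[OF _ sp] sg by (simp add: integrable_measure_pmf_finite)
    also have "\<dots> \<le> x ^ deep_count i g s h * (1 - (1 - x) * (\<kappa> / real s))"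
      using new[of s g] sg x unfolding s_def by (intro mult_left_mono diff_mono) auto
    also have "\<dots> \<le> x ^ deep_count i g s h * exp (- ((1 - x) * (\<kappa> / real s)))"
      using x exp_ge_add_one_self[of "- ((1 - x) * (\<kappa> / real s))"] by (intro mult_left_mono) auto
    also have "- ((1 - x) * (\<kappa> / real s)) = - (1 - x) * \<kappa> * (1 / real s)"
      by (simp only: mult_minus_left mult_1_right times_divide_eq_right mult.assoc)
    finally show ?thesis .
  qed
  have "measure_pmf.expectation (rs_run p t (Suc m) f) (\<lambda>f'. x ^ deep_count i f' (t + Suc m) h) =
      measure_pmf.expectation (rs_run p t m f)
        (\<lambda>g. measure_pmf.expectation (rs_step p s g) (\<lambda>f'. x ^ deep_count i f' (Suc s) h))"
    using rs_run_set[OF st t] finite_set_rs_step t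
    by (simp add: s_def) (subst expectation_bind_finite, auto)
  also have "\<dots> \<le> measure_pmf.expectation (rs_run p t m f)
      (\<lambda>g. x ^ deep_count i g s h * exp (- (1 - x) * \<kappa> * (1 / real s)))"
    by (intro expectation_mono_finite rs_run_set(1) st t step)
  also have "\<dots> = measure_pmf.expectation (rs_run p t m f) (\<lambda>g. x ^ deep_count i g s h) *
      exp (- (1 - x) * \<kappa> * (1 / real s))" by simp
  also have "\<dots> \<le> (x ^ deep_count i f t h * exp (- (1 - x) * \<kappa> * S)) * exp (- (1 - x) * \<kappa> * (1 / real s))"
    using Suc unfolding s_def S_def by (intro mult_right_mono) auto
  also have "\<dots> = x ^ deep_count i f t h * exp (- (1 - x) * \<kappa> * (S + 1 / real s))"
    by (simp add: algebra_simps flip: exp_add)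
  finally show ?case by (simp add: S_def s_def)
qed simp

text \<open>The lower-tail Chernoff bound: since \<open>x < 1\<close>, the power of \<open>x\<close>
  to the count minus \<open>y\<close> is at least 1 on the event, and its expectation is bounded
  above.\<close>

lemma prob_count_less_le:
  assumes t: "0 < t" and st: "surfer_state f" and x: "0 < x" "x < 1" and \<kappa>: "0 \<le> \<kappa>"
    and new: "\<And>s f'. t \<le> s \<Longrightarrow> surfer_state f' \<Longrightarrow> (\<And>h'. deep_count i f t h' \<le> deep_count i f' s h') \<Longrightarrow>
      \<kappa> / real s \<le> measure_pmf.prob (rs_step p s f') {f''. deep i f'' h s}"
  shows "measure_pmf.prob (rs_run p t m f) {f'. real (deep_count i f' (t + m) h) < y} \<le>
    x powr (real (deep_count i f t h) - y) * exp (- (1 - x) * \<kappa> * ln (real (t + m) / real t))"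
proof -
  have "measure_pmf.prob (rs_run p t m f) {f'. real (deep_count i f' (t + m) h) < y} \<le>
      measure_pmf.expectation (rs_run p t m f) (\<lambda>f'. x powr (- y) * x ^ deep_count i f' (t + m) h)"
    unfolding prob_eq_expectation
  proof (intro expectation_mono_finite rs_run_set(1) st t)
    fix f'
    have "x powr (- y) * x ^ deep_count i f' (t + m) h = x powr (real (deep_count i f' (t + m) h) - y)"
      using x by (simp add: powr_diff powr_minus powr_realpow field_simps)
    moreover have "1 \<le> x powr (real (deep_count i f' (t + m) h) - y)" if "real (deep_count i f' (t + m) h) < y"
      using powr_mono'[of "real (deep_count i f' (t + m) h) - y" 0 x] x that by simp
    ultimately show "indicat_real {f'. real (deep_count i f' (t + m) h) < y} f' \<le>
        x powr (- y) * x ^ deep_count i f' (t + m) h"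
      using x by (auto simp: indicator_def)
  qed
  also have "\<dots> = x powr (- y) * measure_pmf.expectation (rs_run p t m f) (\<lambda>f'. x ^ deep_count i f' (t + m) h)"
    by simp
  also have "\<dots> \<le> x powr (- y) * (x ^ deep_count i f t h * exp (- (1 - x) * \<kappa> * (\<Sum>s\<in>{t..<t + m}. 1 / real s)))"
    by (intro mult_left_mono expectation_count_power_le assms) auto
  also have "\<dots> = x powr (real (deep_count i f t h) - y) * exp (- (1 - x) * \<kappa> * (\<Sum>s\<in>{t..<t + m}. 1 / real s))"
    using x by (simp add: powr_diff powr_minus powr_realpow field_simps)
  also have "\<dots> \<le> x powr (real (deep_count i f t h) - y) * exp (- (1 - x) * \<kappa> * ln (real (t + m) / real t))"
    using mult_left_mono[OF ln_ratio_le_harmonic[OF t, of m], of "(1 - x) * \<kappa>"] x \<kappa>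
    by (intro mult_left_mono) auto
  finally show ?thesis .
qed

subsection \<open>The upper bound\<close>

text \<open>Bernoulli's inequality for a real exponent, from the weighted mean of
  \<open>1 + m * x\<close> and 1 with weights \<open>1 / m\<close> and
  \<open>1 - 1 / m\<close>.\<close>

lemma one_plus_mult_le_powr:
  fixes x m :: real
  assumes "0 \<le> x" "1 \<le> m"
  shows "1 + m * x \<le> (1 + x) powr m"
proof -
  have pos: "0 < 1 + m * x" using assms by (simp add: add_pos_nonneg)
  have "(1 + m * x) powr (1 / m) * 1 powr (1 - 1 / m) \<le> (1 / m) * (1 + m * x) + (1 - 1 / m) * 1"
    using assms pos by (intro Youngs_inequality_0) auto
  also have "\<dots> = 1 + x" using assms by (simp add: field_simps)
  finally have "((1 + m * x) powr (1 / m)) powr m \<le> (1 + x) powr m"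
    using assms by (intro powr_mono2) auto
  then show ?thesis using assms pos by (simp add: powr_powr)
qed

lemma power_le_powr_growth:
  fixes a C mh :: real and E :: "nat \<Rightarrow> real"
  assumes mh: "1 < mh" and C: "0 \<le> C" and E: "\<And>s. 0 < s \<Longrightarrow> 0 \<le> E s"
    and step: "\<And>s. 0 < s \<Longrightarrow> E (Suc s) \<le> (1 + mh / real s) * E s + C"
    and n: "0 < n"
  shows "E n \<le> (E 1 + C / (mh - 1)) * real n powr mh"
proof -
  \<comment> \<open>With this \<open>K\<close> the sequence \<open>E s + K * s\<close> satisfies the
    recursion without additive term; \<open>mh > 1\<close> makes it nonnegative.\<close>
  define K where "K = C / (mh - 1)"
  have K: "0 \<le> K" "C + K = K * mh" using C mh by (simp_all add: K_def field_simps)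
  have "E n + K * real n \<le> (E 1 + K) * real n powr mh"
    using n
  proof (induction n rule: nat_induct_non_zero)
    case (Suc s)
    have s: "real s > 0" using Suc by simp
    have "E (Suc s) + K * real (Suc s) \<le> (1 + mh / real s) * E s + (C + K) + K * real s"
      using step[of s] Suc by (simp add: algebra_simps)
    also have "\<dots> = (1 + mh / real s) * (E s + K * real s)"
      using s by (simp add: K field_simps)
    also have "\<dots> \<le> (1 + mh / real s) * ((E 1 + K) * real s powr mh)"
      using Suc mh by (intro mult_left_mono) auto
    also have "\<dots> = (E 1 + K) * ((1 + mh * (1 / real s)) * real s powr mh)" by simp
    also have "\<dots> \<le> (E 1 + K) * ((1 + 1 / real s) powr mh * real s powr mh)"
    proof (intro mult_left_mono mult_right_mono)
      show "1 + mh * (1 / real s) \<le> (1 + 1 / real s) powr mh"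
        using one_plus_mult_le_powr[of "1 / real s" mh] mh s by simp
    qed (use E[of 1] K in auto)
    also have "(1 + 1 / real s) powr mh * real s powr mh = real (Suc s) powr mh"
    proof -
      have "(1 + 1 / real s) * real s = real (Suc s)" using s by (simp add: field_simps)
      then show ?thesis using s by (simp add: powr_mult[symmetric])
    qed
    finally show ?case .
  qed simp
  then show ?thesis using K n mult_nonneg_nonneg[of K "real n"] by (simp add: K_def)
qed


text \<open>Without truncation the factor of \<open>z ^ d\<close> would be exact; truncation at 0
  adds at most 1. Induction on \<open>d\<close> conditions on whether the walk stops at once, with
  probability \<open>p\<close>, or moves one step and starts afresh.\<close>

lemma expectation_geometric_power_le:
  fixes z :: real
  assumes p: "0 < p" "p < 1" and z: "1 < z"
  shows "measure_pmf.expectation (geometric_pmf p) (\<lambda>X. z ^ (d - X)) \<le> p * z / (z - (1 - p)) * z ^ d + 1"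
proof (induction d)
  case 0
  then show ?case using p z by simp
next
  case (Suc d)
  have P: "map_pmf (\<lambda>X. Suc d - X) (geometric_pmf p) =
      bernoulli_pmf p \<bind> (\<lambda>b. if b then return_pmf (Suc d) else map_pmf (\<lambda>X. d - X) (geometric_pmf p))"
    using p by (subst geometric_bind_pmf_unfold)
      (auto simp: map_bind_pmf pmf.map_comp o_def intro!: bind_pmf_cong)
  have fin: "finite (set_pmf (map_pmf (\<lambda>X. d - X) (geometric_pmf p)))" for d
    by (rule finite_subset[of _ "{..d}"]) auto
  have "measure_pmf.expectation (geometric_pmf p) (\<lambda>X. z ^ (Suc d - X)) =
      measure_pmf.expectation (map_pmf (\<lambda>X. Suc d - X) (geometric_pmf p)) (\<lambda>k. z ^ k)"
    by simp
  also have "\<dots> = p * z ^ Suc d +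
      (1 - p) * measure_pmf.expectation (geometric_pmf p) (\<lambda>X. z ^ (d - X))"
    unfolding P using p fin by (subst expectation_bind_finite) auto
  also have "\<dots> \<le> p * z ^ Suc d + (1 - p) * (p * z / (z - (1 - p)) * z ^ d + 1)"
    using Suc p by (intro add_left_mono mult_left_mono) auto
  also have "\<dots> = p * z / (z - (1 - p)) * z ^ Suc d + (1 - p)"
    using p z by (simp add: field_simps)
  finally show ?case using p by simp
qed

text \<open>A new vertex adds on average \<open>growth p z / s\<close> times the current sum, plus
  at most \<open>z\<close> from the reflection. As \<open>mh > 1\<close>, this additive constant
  does not affect the exponent.\<close>

lemma expectation_depth_power_le:
  assumes p: "0 < p" "p < 1" and z: "1 < z" and mh: "1 < mh" "growth p z \<le> mh"
  obtains K where "\<And>n. 0 < n \<Longrightarrow>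
    measure_pmf.expectation (rs_tree p n) (\<lambda>f. \<Sum>u<n. z ^ depth f u) \<le> K * real n powr mh"
proof -
  define E where "E n = measure_pmf.expectation (rs_tree p n) (\<lambda>f. \<Sum>u<n. z ^ depth f u)" for n
  have E: "0 \<le> E n" for n
    using z unfolding E_def by (intro integral_nonneg_AE) (auto intro!: sum_nonneg)
  have step: "E (Suc s) \<le> (1 + mh / real s) * E s + z" if s: "0 < s" for s
  proof -
    have "measure_pmf.expectation (rs_step p s f) (\<lambda>f'. \<Sum>u<Suc s. z ^ depth f' u) \<le>
        (1 + mh / real s) * (\<Sum>u<s. z ^ depth f u) + z"
      if st: "surfer_state f" for f
    proof -
      define Z where "Z = (\<Sum>u<s. z ^ depth f u)"
      have Z: "0 \<le> Z" using z by (auto simp: Z_def intro!: sum_nonneg)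
      have "measure_pmf.expectation (rs_step p s f) (\<lambda>f'. \<Sum>u<Suc s. z ^ depth f' u) =
          (\<Sum>u<s. measure_pmf.expectation (geometric_pmf p) (\<lambda>X. Z + z * z ^ (depth f u - X))) / real s"
      proof (subst expectation_rs_step[OF st s], intro arg_cong2[where f = "(/)"] sum.cong refl)
        fix u assume "u \<in> {..<s}"
        then have y: "(f ^^ X) u < s" for X using funpow_le[OF st, of X u] by simp
        then have "(\<Sum>v<Suc s. z ^ depth (f(s := (f ^^ X) u)) v) = Z + z * z ^ (depth f u - X)" for X
          by (simp add: Z_def depth_upd[OF st y] depth_new[OF st y] depth_funpow[OF st] del: fun_upd_apply)
        then show "measure_pmf.expectation (geometric_pmf p)
            (\<lambda>X. \<Sum>v<Suc s. z ^ depth (f(s := (f ^^ X) u)) v) =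
          measure_pmf.expectation (geometric_pmf p) (\<lambda>X. Z + z * z ^ (depth f u - X))" by simp
      qed
      also have "\<dots> \<le> (\<Sum>u<s. Z + z * (p * z / (z - (1 - p)) * z ^ depth f u + 1)) / real s"
      proof (intro divide_right_mono sum_mono)
        fix u
        have "integrable (geometric_pmf p) (\<lambda>X. z ^ (depth f u - X))"
          using z by (intro measure_pmf.integrable_const_bound[of _ "z ^ depth f u"])
            (auto intro!: AE_pmfI power_increasing)
        then have "measure_pmf.expectation (geometric_pmf p) (\<lambda>X. Z + z * z ^ (depth f u - X)) =
            Z + z * measure_pmf.expectation (geometric_pmf p) (\<lambda>X. z ^ (depth f u - X))" by simp
        then show "measure_pmf.expectation (geometric_pmf p) (\<lambda>X. Z + z * z ^ (depth f u - X)) \<le>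
            Z + z * (p * z / (z - (1 - p)) * z ^ depth f u + 1)"
          using mult_left_mono[OF expectation_geometric_power_le[OF p z, of "depth f u"], of z] z by simp
      qed auto
      also have "\<dots> = Z + growth p z / real s * Z + z"
      proof -
        have "(\<Sum>u<s. Z + z * (p * z / (z - (1 - p)) * z ^ depth f u + 1)) =
            real s * Z + growth p z * Z + real s * z"
          by (simp add: Z_def growth_def sum.distrib sum_distrib_left sum_divide_distrib
              power2_eq_square algebra_simps)
        then show ?thesis using s by (simp add: field_simps)
      qed
      also have "\<dots> \<le> (1 + mh / real s) * Z + z"
        using mult_right_mono[OF divide_right_mono[OF mh(2), of "real s"] Z] by (simp add: algebra_simps)
      finally show ?thesis by (simp add: Z_def)
    qed
    then have "E (Suc s) \<le> measure_pmf.expectation (rs_tree p s)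
        (\<lambda>f. (1 + mh / real s) * (\<Sum>u<s. z ^ depth f u) + z)"
      unfolding E_def rs_tree_Suc[OF s] using rs_tree_set[OF s] finite_set_rs_step[OF _ s]
      by (subst expectation_bind_finite) (auto intro!: expectation_mono_finite)
    also have "\<dots> = (1 + mh / real s) * E s + z"
      using rs_tree_set(1)[OF s] by (simp add: E_def integrable_measure_pmf_finite)
    finally show ?thesis .
  qed
  have "E n \<le> (E 1 + z / (mh - 1)) * real n powr mh" if "0 < n" for n
    using z by (intro power_le_powr_growth mh E step that) auto
  then show ?thesis using that unfolding E_def by blast
qed

lemma rs_diam_upper:
  assumes p: "0 < p" "p < 1" and \<epsilon>: "0 < \<epsilon>"
  shows "(\<lambda>n. measure_pmf.prob (rs_tree p n)
    {f. (2 * cU p + \<epsilon>) * ln (real n) < real (rs_diam f n)}) \<longlonglongrightarrow> 0"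
proof -
  obtain z where z: "1 < z" "1 \<le> cU p * ln z" "growth p z \<le> cU p * ln z"
    using growth_cU[OF p] .
  define l where "l = ln z"
  have l: "0 < l" "z = exp l" using z by (simp_all add: l_def)
  \<comment> \<open>The height may exceed \<open>cU p * ln n\<close> by
    \<open>(\<epsilon> / 2) * ln n\<close>. One half of this makes \<open>mh\<close> exceed 1
    strictly, the other half is left as the decay exponent \<open>g\<close> in Markov's
    inequality.\<close>
  define mh where "mh = (cU p + \<epsilon> / 4) * l"
  have "mh = cU p * l + \<epsilon> * l / 4" "0 < \<epsilon> * l" using \<epsilon> l by (simp_all add: mh_def algebra_simps)
  then have mh: "1 < mh" "growth p z \<le> mh" using z(2,3)[folded l_def] by linarith+
  obtain K where K: "\<And>n. 0 < n \<Longrightarrow>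
    measure_pmf.expectation (rs_tree p n) (\<lambda>f. \<Sum>u<n. z ^ depth f u) \<le> K * real n powr mh"
    using expectation_depth_power_le[OF p z(1) mh] by blast
  define g where "g = \<epsilon> / 4 * l"
  have g: "0 < g" using l \<epsilon> by (simp add: g_def)
  have bound: "measure_pmf.prob (rs_tree p n) {f. (2 * cU p + \<epsilon>) * ln (real n) < real (rs_diam f n)}
      \<le> K * real n powr (- g)" if n: "0 < n" for n
  proof -
    define y where "y = (cU p + \<epsilon> / 2) * ln (real n)"
    have "measure_pmf.prob (rs_tree p n) {f. (2 * cU p + \<epsilon>) * ln (real n) < real (rs_diam f n)} \<le>
        measure_pmf.expectation (rs_tree p n) (\<lambda>f. exp (- l * y) * (\<Sum>u<n. z ^ depth f u))"
      unfolding prob_eq_expectation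
    proof (intro expectation_mono_finite rs_tree_set(1) n)
      fix f assume "f \<in> set_pmf (rs_tree p n)"
      then have st: "surfer_state f" using rs_tree_set(2) n by blast
      have nonneg: "0 \<le> exp (- l * y) * (\<Sum>u<n. z ^ depth f u)"
        using z by (auto intro!: mult_nonneg_nonneg sum_nonneg)
      have "1 \<le> exp (- l * y) * (\<Sum>u<n. z ^ depth f u)"
        if big: "(2 * cU p + \<epsilon>) * ln (real n) < real (rs_diam f n)"
      proof -
        have "\<exists>u<n. y < real (depth f u)"
        proof (rule ccontr)
          assume "\<not> (\<exists>u<n. y < real (depth f u))"
          then have a: "real (depth f u) \<le> y" if "u < n" for u using that by (meson not_less)
          have "depth f u \<le> nat \<lfloor>y\<rfloor>" if "u < n" for u using a[OF that] by linarith
          then have "rs_diam f n \<le> 2 * nat \<lfloor>y\<rfloor>" using rs_diam_le[OF st n] by blast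
          moreover have "0 \<le> y" using a[OF n] depth_0[OF st] by simp
          ultimately have "real (rs_diam f n) \<le> 2 * y" by linarith
          then show False using big by (simp add: y_def algebra_simps)
        qed
        then obtain u where u: "u < n" "y < real (depth f u)" by blast
        have "1 \<le> exp (- l * y) * exp (l * real (depth f u))"
          using u l by (simp add: mult_left_mono flip: exp_add)
        also have "exp (l * real (depth f u)) = z ^ depth f u"
          by (simp add: l(2) exp_of_nat2_mult)
        also have "z ^ depth f u \<le> (\<Sum>u<n. z ^ depth f u)"
          using z u by (intro member_le_sum) auto
        finally show ?thesis by simp
      qed
      with nonneg show "indicat_real {f. (2 * cU p + \<epsilon>) * ln (real n) < real (rs_diam f n)} f \<le>
          exp (- l * y) * (\<Sum>u<n. z ^ depth f u)" by (auto simp: indicator_def)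
    qed
    also have "\<dots> \<le> exp (- l * y) * (K * real n powr mh)" using K[OF n] by simp
    also have "\<dots> = K * (real n powr mh * exp (- l * y))" by simp
    also have "real n powr mh * exp (- l * y) = real n powr (- g)"
      using n by (simp add: powr_def y_def mh_def g_def algebra_simps flip: exp_add)
    finally show ?thesis .
  qed
  have "(\<lambda>n. K * real n powr (- g)) \<longlonglongrightarrow> K * 0"
    using g by (intro tendsto_mult tendsto_const) real_asymp
  then have "(\<lambda>n. K * real n powr (- g)) \<longlonglongrightarrow> 0" by simp
  then show ?thesis
  proof (rule tendsto_sandwich[rotated -1])
    show "eventually (\<lambda>n. measure_pmf.prob (rs_tree p n)
      {f. (2 * cU p + \<epsilon>) * ln (real n) < real (rs_diam f n)} \<le> K * real n powr (- g)) sequentially"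
      using eventually_gt_at_top[of 0] by eventually_elim (rule bound)
  qed auto
qed

subsection \<open>Rounds and blocks\<close>

lemma prob_Bex_le_sum:
  assumes "finite I"
  shows "measure_pmf.prob M {x. \<exists>i\<in>I. P i x} \<le> (\<Sum>i\<in>I. measure_pmf.prob M {x. P i x})"
proof -
  have "{x. \<exists>i\<in>I. P i x} = (\<Union>i\<in>I. {x. P i x})" by auto
  then show ?thesis using assms
    by (simp add: measure_pmf.finite_measure_subadditive_finite)
qed

text \<open>Given the bounds at the start of the round, the number of new vertices at level
  \<open>H + k\<close> has conditional intensity at least \<open>M * \<beta> k / s\<close>, and the
  Chernoff bound keeps a fraction \<open>1 - \<eta>\<close> of the total. The window of levels moves
  up by one because level \<open>k\<close> draws on level \<open>k - 1\<close> and above;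
  \<open>H \<ge> B + 2\<close> keeps absolute levels at least 2.\<close>

lemma round_success:
  fixes p \<eta> d :: real
  assumes p: "0 < p" "p < 1" and \<eta>: "0 < \<eta>" "\<eta> < 1" and d: "0 < d"
  defines "b \<equiv> (1 - \<eta>) * d"
  obtains C where "0 \<le> C" "\<And>t m H M i. \<lbrakk>0 < t; exp d * real t \<le> real (t + m); int B + 2 \<le> H; 0 < M\<rbrakk> \<Longrightarrow>
    measure_pmf.prob (rs_tree p (t + m))
      {f. \<exists>k\<in>{int (Suc a) - int B..int (Suc a)}. real (deep_count i f (t + m) (H + k)) < M * front p N b (Suc a) k} \<le>
    measure_pmf.prob (rs_tree p t)
      {f. \<exists>k\<in>{int a - int B..int a}. real (deep_count i f t (H + k)) < M * front p N b a k} + C / M"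
proof -
  define \<beta> where "\<beta> k = (\<Sum>j<N. p * (1 - p) ^ j * front p N b a (k - 1 + int j))" for k
  have b: "0 < b" using \<eta> d by (simp add: b_def)
  have \<beta>: "0 \<le> \<beta> k" for k
    unfolding \<beta>_def using p b by (auto intro!: sum_nonneg mult_nonneg_nonneg front_nonneg)
  \<comment> \<open>The Chernoff exponent per unit of mean for \<open>x = 1 - \<eta>\<close> and the
    fraction \<open>1 - \<eta>\<close>.\<close>
  define \<theta> where "\<theta> = \<eta> + (1 - \<eta>) * ln (1 - \<eta>)"
  have "ln (1 / (1 - \<eta>)) < 1 / (1 - \<eta>) - 1"
    using ln_le_minus_one[of "1 / (1 - \<eta>)"] ln_eq_minus_one[of "1 / (1 - \<eta>)"] \<eta> by fastforce
  then have "(1 - \<eta>) * ln (1 / (1 - \<eta>)) < (1 - \<eta>) * (1 / (1 - \<eta>) - 1)"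
    using \<eta> by (intro mult_strict_left_mono) auto
  also have "\<dots> = \<eta>" using \<eta> by (simp add: field_simps)
  finally have \<theta>: "0 < \<theta>" using \<eta> by (simp add: \<theta>_def ln_div)
  define I where "I = {int (Suc a) - int B..int (Suc a)}"
  define C where "C = (\<Sum>k\<in>I. 1 / (\<theta> * d * \<beta> k))"
  show ?thesis
  proof (rule that[of C])
    show "0 \<le> C" unfolding C_def using \<theta> d \<beta> by (auto intro!: sum_nonneg)
    fix t m H M i
    assume t: "0 < t" and tm: "exp d * real t \<le> real (t + m)" and H: "int B + 2 \<le> H" and M: "0 < (M::real)"
    have "0 \<le> C / M" using \<open>0 \<le> C\<close> M by simp
    then show "measure_pmf.prob (rs_tree p (t + m))
        {f. \<exists>k\<in>{int (Suc a) - int B..int (Suc a)}. real (deep_count i f (t + m) (H + k)) < M * front p N b (Suc a) k} \<le>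
      measure_pmf.prob (rs_tree p t)
        {f. \<exists>k\<in>{int a - int B..int a}. real (deep_count i f t (H + k)) < M * front p N b a k} + C / M"
    proof (rule prob_rs_tree_add_le[OF t])
      fix f assume st: "surfer_state f"
        and "f \<notin> {f. \<exists>k\<in>{int a - int B..int a}. real (deep_count i f t (H + k)) < M * front p N b a k}"
      \<comment> \<open>Above the window \<open>front\<close> is 0, so the bound holds there
        too.\<close>
      then have ge: "M * front p N b a k \<le> real (deep_count i f t (H + k))" if "int a - int B \<le> k" for k
        using that front_eq_0[of a k p N b] by (cases "k \<le> int a") (auto simp: not_less)
      have each: "measure_pmf.prob (rs_run p t m f)
          {f'. real (deep_count i f' (t + m) (H + k)) < M * front p N b (Suc a) k} \<le> 1 / (\<theta> * d * \<beta> k) / M"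
        if k: "k \<in> I" for k
      \<comment> \<open>Division by zero makes the bound 0 in this case, so failure has to be
        impossible: \<open>front\<close> does not change at \<open>k\<close>, and counts never
        decrease.\<close>
      proof (cases "\<beta> k = 0")
        case True
        then have "M * front p N b (Suc a) k = M * front p N b a k" by (simp add: \<beta>_def)
        also have "\<dots> \<le> real (deep_count i f t (H + k))" using ge[of k] k by (simp add: I_def)
        finally have "\<not> real (deep_count i f' (t + m) (H + k)) < M * front p N b (Suc a) k"
          if "f' \<in> set_pmf (rs_run p t m f)" for f'
          using rs_run_set(2)[OF st t that, of i "H + k"] by linarith
        then have "measure_pmf.prob (rs_run p t m f)
            {f'. real (deep_count i f' (t + m) (H + k)) < M * front p N b (Suc a) k} = 0"
          by (subst measure_pmf_zero_iff) auto
        then show ?thesis using True by simp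
      next
        case False
        then have \<beta>k: "0 < \<beta> k" using \<beta>[of k] by simp
        define \<kappa> where "\<kappa> = M * \<beta> k"
        have \<kappa>: "0 < \<kappa>" using M \<beta>k by (simp add: \<kappa>_def)
        have h: "2 \<le> H + k" using H k by (simp add: I_def)
        have new: "\<kappa> / real s \<le> measure_pmf.prob (rs_step p s g) {f''. deep i f'' (H + k) s}"
          if s: "t \<le> s" and sg: "surfer_state g"
            and mono: "\<And>h'. deep_count i f t h' \<le> deep_count i g s h'" for s g
        proof -
          have "\<kappa> \<le> (\<Sum>j<N. p * (1 - p) ^ j * real (deep_count i g s (H + k - 1 + int j)))"
            unfolding \<kappa>_def \<beta>_def sum_distrib_left
          proof (rule sum_mono)
            fix j assume "j \<in> {..<N}"
            have "M * front p N b a (k - 1 + int j) \<le> real (deep_count i f t (H + (k - 1 + int j)))"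
              using k by (intro ge) (simp add: I_def)
            also have "\<dots> \<le> real (deep_count i g s (H + k - 1 + int j))"
              using mono[of "H + (k - 1 + int j)"] by (simp add: algebra_simps)
            finally have "p * (1 - p) ^ j * (M * front p N b a (k - 1 + int j)) \<le>
                p * (1 - p) ^ j * real (deep_count i g s (H + k - 1 + int j))"
              using p by (intro mult_left_mono) auto
            then show "M * (p * (1 - p) ^ j * front p N b a (k - 1 + int j)) \<le>
                p * (1 - p) ^ j * real (deep_count i g s (H + k - 1 + int j))" by (simp add: mult_ac)
          qed
          then have "\<kappa> / real s \<le>
              (\<Sum>j<N. p * (1 - p) ^ j * real (deep_count i g s (H + k - 1 + int j))) / real s"
            by (intro divide_right_mono) auto
          also have "\<dots> \<le> measure_pmf.prob (rs_step p s g) {f''. deep i f'' (H + k) s}"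
            using prob_deep_new_ge[OF p sg _ h] t s by simp
          finally show ?thesis .
        qed
        define W where "W = real (deep_count i f t (H + k))"
        define y where "y = M * front p N b (Suc a) k"
        have y: "y = M * front p N b a k + b * \<kappa>" by (simp add: y_def \<kappa>_def \<beta>_def algebra_simps)
        have W: "M * front p N b a k \<le> W" unfolding W_def using k by (intro ge) (simp add: I_def)
        have "measure_pmf.prob (rs_run p t m f) {f'. real (deep_count i f' (t + m) (H + k)) < y} \<le>
            (1 - \<eta>) powr (W - y) * exp (- (1 - (1 - \<eta>)) * \<kappa> * ln (real (t + m) / real t))"
          unfolding W_def using \<eta> \<kappa> by (intro prob_count_less_le[OF t st _ _ _ new]) auto
        also have "\<dots> \<le> (1 - \<eta>) powr (- (b * \<kappa>)) * exp (- (1 - (1 - \<eta>)) * \<kappa> * d)"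
        proof (intro mult_mono)
          show "(1 - \<eta>) powr (W - y) \<le> (1 - \<eta>) powr (- (b * \<kappa>))"
            using y W \<eta> by (intro powr_mono') auto
          have "d \<le> ln (real (t + m) / real t)"
            using t tm by (subst ln_ge_iff) (auto simp: field_simps)
          then have "(\<eta> * \<kappa>) * d \<le> (\<eta> * \<kappa>) * ln (real (t + m) / real t)"
            using \<eta> \<kappa> by (intro mult_left_mono) auto
          then show "exp (- (1 - (1 - \<eta>)) * \<kappa> * ln (real (t + m) / real t)) \<le> exp (- (1 - (1 - \<eta>)) * \<kappa> * d)"
            by simp
        qed auto
        also have "\<dots> = exp (- (\<theta> * d * \<kappa>))"
          using \<eta> by (simp add: powr_def b_def \<theta>_def algebra_simps flip: exp_add)
        \<comment> \<open>An error of order \<open>1 / M\<close> suffices, since \<open>M\<close>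
          doubles from block to block.\<close>
        also have "\<dots> \<le> 1 / (\<theta> * d * \<kappa>)"
        proof -
          define x where "x = \<theta> * d * \<kappa>"
          have "0 < x" using \<theta> d \<kappa> by (simp add: x_def)
          moreover have "x \<le> exp x" using exp_ge_add_one_self[of x] by linarith
          ultimately have "exp (- x) \<le> 1 / x" by (simp add: exp_minus field_simps)
          then show ?thesis by (simp add: x_def)
        qed
        finally show ?thesis by (simp add: y_def \<kappa>_def mult_ac)
      qed
      have "measure_pmf.prob (rs_run p t m f)
          {f'. \<exists>k\<in>I. real (deep_count i f' (t + m) (H + k)) < M * front p N b (Suc a) k} \<le>
        (\<Sum>k\<in>I. 1 / (\<theta> * d * \<beta> k) / M)"
      proof (rule order_trans[OF prob_Bex_le_sum])
        show "finite I" by (simp add: I_def)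
      qed (intro sum_mono each)
      then show "measure_pmf.prob (rs_run p t m f)
          {f. \<exists>k\<in>{int (Suc a) - int B..int (Suc a)}. real (deep_count i f (t + m) (H + k)) < M * front p N b (Suc a) k} \<le> C / M"
        unfolding C_def sum_divide_distrib I_def .
    qed
  qed
qed

text \<open>Rounding up gives every round a logarithmic length of at least \<open>d\<close>.\<close>

definition next_time :: "real \<Rightarrow> nat \<Rightarrow> nat" where
  "next_time d t = nat \<lceil>exp d * real t\<rceil>"

lemma next_time_ge: "exp d * real t \<le> real (next_time d t)"
  unfolding next_time_def by linarith

lemma next_time_le: "real (next_time d t) \<le> exp d * real t + 1"
proof -
  have "0 \<le> exp d * real t" by simp
  then show ?thesis unfolding next_time_def by linarith
qed

lemma next_time_ge_self: "0 < d \<Longrightarrow> t \<le> next_time d t"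
proof -
  assume "0 < d"
  then have "1 * real t \<le> exp d * real t" by (intro mult_right_mono) auto
  then show ?thesis using next_time_ge[of d t] by linarith
qed

lemma funpow_next_time_ge: "0 < d \<Longrightarrow> t \<le> (next_time d ^^ a) t"
  by (induction a) (auto intro: order_trans next_time_ge_self)

text \<open>The shift \<open>c = 1 / (exp d - 1)\<close> absorbs the rounding:
  \<open>exp d * t + 1 + c = exp d * (t + c)\<close>. All roundings together thus cost only an
  additive constant in the initial time.\<close>

lemma funpow_next_time_le:
  assumes "0 < d"
  shows "real ((next_time d ^^ a) t) \<le> exp (d * real a) * (real t + 1 / (exp d - 1))"
proof -
  define c where "c = 1 / (exp d - 1)"
  have c: "exp d * c = c + 1" "0 < c" using assms by (simp_all add: c_def field_simps)
  have "real ((next_time d ^^ a) t) + c \<le> exp (d * real a) * (real t + c)"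
  proof (induction a)
    case (Suc a)
    have "real ((next_time d ^^ Suc a) t) + c \<le> exp d * (real ((next_time d ^^ a) t) + c)"
      using next_time_le[of d "(next_time d ^^ a) t"] c by (simp add: algebra_simps)
    also have "\<dots> \<le> exp d * (exp (d * real a) * (real t + c))" using Suc by (intro mult_left_mono) auto
    also have "\<dots> = exp (d * real (Suc a)) * (real t + c)" by (simp add: algebra_simps exp_add)
    finally show ?case .
  qed simp
  then show ?thesis using c unfolding c_def by linarith
qed

text \<open>Chaining \<open>r\<close> rounds and adding their error constants. Initially all levels
  at most 0 hold at least \<open>M\<close> vertices because level 0 does; finally level
  \<open>j\<close> holds at least \<open>2 * M\<close>. The constant is uniform in \<open>t\<close>,
  \<open>H\<close>, \<open>M\<close> and \<open>i\<close>, so blocks can be chained in turn.\<close>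

lemma block_success:
  fixes p \<eta> d :: real
  assumes p: "0 < p" "p < 1" and \<eta>: "0 < \<eta>" "\<eta> < 1" and d: "0 < d"
    and front: "2 \<le> front p N ((1 - \<eta>) * d) r (int j)"
  obtains C where "0 \<le> C" "\<And>t H M i. \<lbrakk>0 < t; int r + 2 \<le> H; 0 < M\<rbrakk> \<Longrightarrow>
    measure_pmf.prob (rs_tree p ((next_time d ^^ r) t))
      {f. real (deep_count i f ((next_time d ^^ r) t) (H + int j)) < 2 * M} \<le>
    measure_pmf.prob (rs_tree p t) {f. real (deep_count i f t H) < M} + C / M"
proof -
  define b where "b = (1 - \<eta>) * d"
  \<comment> \<open>The window has depth \<open>r\<close>, so over \<open>r\<close> rounds it slides
    from \<open>-r..0\<close> to \<open>0..r\<close> and ends by containing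
    \<open>j\<close>.\<close>
  define bad where "bad i t H M a = measure_pmf.prob (rs_tree p t)
    {f. \<exists>k\<in>{int a - int r..int a}. real (deep_count i f t (H + k)) < M * front p N b a k}" for i t H M a
  define bad0 where "bad0 i t H M = measure_pmf.prob (rs_tree p t) {f. real (deep_count i f t H) < M}" for i t H M
  have "\<exists>C\<ge>0. \<forall>t H M i. 0 < t \<longrightarrow> int r + 2 \<le> H \<longrightarrow> 0 < M \<longrightarrow>
      bad i ((next_time d ^^ a) t) H M a \<le> bad0 i t H M + C / M" for a
  proof (induction a)
    case 0
    have "bad i t H M 0 \<le> bad0 i t H M" if "0 < t" for i H M and t :: nat
    proof -
      have "{f. \<exists>k\<in>{int 0 - int r..int 0}. real (deep_count i f t (H + k)) < M * front p N b 0 k} \<subseteq>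
          {f. real (deep_count i f t H) < M}"
      proof safe
        fix f k assume "k \<in> {int 0 - int r..int 0}" "real (deep_count i f t (H + k)) < M * front p N b 0 k"
        moreover from this have "deep_count i f t H \<le> deep_count i f t (H + k)"
          by (intro deep_count_antimono) auto
        ultimately show "real (deep_count i f t H) < M" by simp
      qed
      then show ?thesis unfolding bad_def bad0_def by (intro measure_pmf.finite_measure_mono) auto
    qed
    then show ?case by (intro exI[of _ 0]) simp
  next
    case (Suc a)
    then obtain C where C: "0 \<le> C" "\<And>t H M i. 0 < t \<Longrightarrow> int r + 2 \<le> H \<Longrightarrow> 0 < M \<Longrightarrow>
      bad i ((next_time d ^^ a) t) H M a \<le> bad0 i t H M + C / M" by blast
    obtain C' where C': "0 \<le> C'" "\<And>t m H M i. \<lbrakk>0 < t; exp d * real t \<le> real (t + m); int r + 2 \<le> H; 0 < M\<rbrakk> \<Longrightarrow>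
        bad i (t + m) H M (Suc a) \<le> bad i t H M a + C' / M"
      using round_success[OF p \<eta> d, of r a N] unfolding bad_def b_def by blast
    have "bad i ((next_time d ^^ Suc a) t) H M (Suc a) \<le> bad0 i t H M + (C + C') / M"
      if "0 < t" "int r + 2 \<le> H" "0 < M" for t :: nat and H M i
    proof -
      define t' where "t' = (next_time d ^^ a) t"
      have t': "0 < t'" using funpow_next_time_ge[OF d, of t a] that by (simp add: t'_def)
      have e: "t' + (next_time d t' - t') = next_time d t'" using next_time_ge_self[OF d, of t'] by simp
      have "bad i (next_time d t') H M (Suc a) \<le> bad i t' H M a + C' / M"
        using C'(2)[OF t', of "next_time d t' - t'" H M i] that next_time_ge[of d t'] by (simp only: e)
      also have "\<dots> \<le> bad0 i t H M + C / M + C' / M" using C(2)[OF that] by (simp add: t'_def)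
      finally show ?thesis by (simp add: t'_def add_divide_distrib)
    qed
    then show ?case using C(1) C'(1) by (intro exI[of _ "C + C'"]) auto
  qed
  then obtain C where C: "0 \<le> C" "\<And>t H M i. 0 < t \<Longrightarrow> int r + 2 \<le> H \<Longrightarrow> 0 < M \<Longrightarrow>
      bad i ((next_time d ^^ r) t) H M r \<le> bad0 i t H M + C / M" by blast
  show ?thesis
  proof (rule that[OF C(1)])
    fix t :: nat and H M i assume a: "0 < t" "int r + 2 \<le> H" "0 < (M::real)"
    have "j \<le> r" using front front_eq_0[of r "int j" p N b] by (force simp: b_def)
    moreover have "2 * M \<le> M * front p N b r (int j)"
      using mult_left_mono[OF front, of M] a by (simp add: b_def mult.commute)
    ultimately have "measure_pmf.prob (rs_tree p ((next_time d ^^ r) t))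
      {f. real (deep_count i f ((next_time d ^^ r) t) (H + int j)) < 2 * M} \<le>
      bad i ((next_time d ^^ r) t) H M r"
      unfolding bad_def
    proof (intro measure_pmf.finite_measure_mono subsetI)
      fix f assume "f \<in> {f. real (deep_count i f ((next_time d ^^ r) t) (H + int j)) < 2 * M}"
      with \<open>2 * M \<le> _\<close> have "real (deep_count i f ((next_time d ^^ r) t) (H + int j)) < M * front p N b r (int j)"
        by (metis mem_Collect_eq less_le_trans)
      then show "f \<in> {f. \<exists>k\<in>{int r - int r..int r}.
          real (deep_count i f ((next_time d ^^ r) t) (H + k)) < M * front p N b r k}"
        using \<open>j \<le> r\<close> by auto
    qed auto
    then show "measure_pmf.prob (rs_tree p ((next_time d ^^ r) t))
      {f. real (deep_count i f ((next_time d ^^ r) t) (H + int j)) < 2 * M} \<le>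
      measure_pmf.prob (rs_tree p t) {f. real (deep_count i f t H) < M} + C / M"
      using C(2)[OF a, of i] by (simp add: bad0_def)
  qed
qed

text \<open>Block number \<open>n\<close>, counted from 0, starts from \<open>2 ^ n * M\<close>
  vertices and fails with additional probability at most \<open>C / (2 ^ n * M)\<close>; the
  induction carries the exact partial geometric sum.\<close>

lemma blocks_success:
  fixes p d C :: real
  assumes d: "0 < d" and C: "0 \<le> C"
    and block: "\<And>t H M. \<lbrakk>0 < t; int r + 2 \<le> H; 0 < M\<rbrakk> \<Longrightarrow>
    measure_pmf.prob (rs_tree p ((next_time d ^^ r) t))
      {f. real (deep_count i f ((next_time d ^^ r) t) (H + int j)) < 2 * M} \<le>
    measure_pmf.prob (rs_tree p t) {f. real (deep_count i f t H) < M} + C / M"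
    and t: "0 < t" and H: "int r + 2 \<le> H" and M: "0 < M"
  shows "measure_pmf.prob (rs_tree p ((next_time d ^^ (r * n)) t))
      {f. real (deep_count i f ((next_time d ^^ (r * n)) t) (H + int (j * n))) < 2 ^ n * M} \<le>
    measure_pmf.prob (rs_tree p t) {f. real (deep_count i f t H) < M} + 2 * C / M"
proof -
  define P where "P n = measure_pmf.prob (rs_tree p ((next_time d ^^ (r * n)) t))
      {f. real (deep_count i f ((next_time d ^^ (r * n)) t) (H + int (j * n))) < 2 ^ n * M}" for n
  have "P n \<le> P 0 + 2 * C / M * (1 - 1 / 2 ^ n)"
  proof (induction n)
    case (Suc n)
    define t' where "t' = (next_time d ^^ (r * n)) t"
    have "0 < t'" using funpow_next_time_ge[OF d, of t "r * n"] t by (simp add: t'_def)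
    moreover have "(next_time d ^^ r) t' = (next_time d ^^ (r * Suc n)) t"
      by (simp add: t'_def funpow_add)
    moreover have "int r + 2 \<le> H + int (j * n)" using H by (intro order_trans[OF H]) simp
    ultimately have "P (Suc n) \<le> P n + C / (2 ^ n * M)"
      using block[of t' "H + int (j * n)" "2 ^ n * M"] H M
      by (simp add: P_def t'_def algebra_simps)
    also have "\<dots> \<le> P 0 + 2 * C / M * (1 - 1 / 2 ^ n) + C / (2 ^ n * M)" using Suc by simp
    also have "\<dots> = P 0 + 2 * C / M * (1 - 1 / 2 ^ Suc n)" using M by (simp add: field_simps)
    finally show ?case .
  qed simp
  also have "2 * C / M * (1 - 1 / 2 ^ n) \<le> 2 * C / M * 1" using C M by (intro mult_left_mono) auto
  finally show ?thesis by (simp add: P_def)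
qed

subsection \<open>The lower bound and the theorem\<close>

text \<open>From time 2 on, step \<open>s\<close> attaches to the root with probability at least
  \<open>1 / s\<close>. The Chernoff bound with \<open>x = 1/2\<close> gives a bound of order
  \<open>T\<close> to the power -1/2.\<close>

lemma prob_few_False_tendsto:
  "(\<lambda>T. measure_pmf.prob (rs_tree p T) {f. real (deep_count False f T 1) < 1}) \<longlonglongrightarrow> 0"
proof (rule tendsto_sandwich[OF _ _ tendsto_const])
  define h where "h T = 2 * exp (- (1/2) * ln (real T / 2))" for T
  show "h \<longlonglongrightarrow> 0" unfolding h_def by real_asymp
  show "eventually (\<lambda>T. measure_pmf.prob (rs_tree p T) {f. real (deep_count False f T 1) < 1} \<le> h T) sequentially"
    using eventually_ge_at_top[of 2]
  proof eventually_elim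
    case (elim T)
    have "measure_pmf.prob (rs_tree p (2 + (T - 2))) {f. real (deep_count False f (2 + (T - 2)) 1) < 1} \<le>
        measure_pmf.prob (rs_tree p 2) {} + h T"
    proof (rule prob_rs_tree_add_le)
      fix f assume st: "surfer_state f"
      have "measure_pmf.prob (rs_run p 2 (T - 2) f) {f'. real (deep_count False f' (2 + (T - 2)) 1) < 1} \<le>
        (1/2) powr (real (deep_count False f 2 1) - 1) * exp (- (1 - 1/2) * 1 * ln (real (2 + (T - 2)) / real 2))"
      proof (rule prob_count_less_le[OF _ st])
        show "1 / real s \<le> measure_pmf.prob (rs_step p s f') {f''. deep False f'' 1 s}"
          if "2 \<le> s" "surfer_state f'" for s f'
          using that by (rule prob_attach_root_ge[rotated])
      qed simp_all
      also have "\<dots> \<le> (1/2) powr (- 1) * exp (- (1 - 1/2) * 1 * ln (real (2 + (T - 2)) / real 2))"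
        by (intro mult_right_mono powr_mono') auto
      also have "\<dots> = h T" using elim by (simp add: h_def powr_minus)
      finally show "measure_pmf.prob (rs_run p 2 (T - 2) f)
        {f. real (deep_count False f (2 + (T - 2)) 1) < 1} \<le> h T" .
    qed (auto simp: h_def)
    moreover have "2 + (T - 2) = T" using elim by simp
    ultimately show ?case by (simp only: measure_empty add_0_left)
  qed
  show "eventually (\<lambda>T. 0 \<le> measure_pmf.prob (rs_tree p T) {f. real (deep_count False f T 1) < 1}) sequentially"
    by (intro always_eventually allI measure_nonneg)
qed

lemma prob_few_True_tendsto:
  "(\<lambda>T. measure_pmf.prob (rs_tree p T) {f. real (deep_count True f T 1) < 1}) \<longlonglongrightarrow> 0"
proof (rule tendsto_eventually)
  show "eventually (\<lambda>T. measure_pmf.prob (rs_tree p T) {f. real (deep_count True f T 1) < 1} = 0) sequentially"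
    using eventually_ge_at_top[of 2]
  proof eventually_elim
    case (elim T)
    have "1 \<le> deep_count True f T 1" if "f \<in> set_pmf (rs_tree p T)" for f
    proof -
      have st: "surfer_state f" using rs_tree_set(2)[OF _ that] elim by simp
      have "deep True f 1 1" using below1_1[OF st] depth_pos[OF st, of 1] by (simp add: deep_def)
      then have "card {1::nat} \<le> deep_count True f T 1"
        unfolding deep_count_def using elim by (intro card_mono) auto
      then show ?thesis by simp
    qed
    then show ?case by (subst measure_pmf_zero_iff) force
  qed
qed

text \<open>Once a single vertex at level \<open>h\<close> exists, choosing such a vertex with a
  walk of length 0 creates level \<open>h + 1\<close> with probability at least
  \<open>p / s\<close>; divergence of the harmonic series then yields any number
  \<open>M\<close>.\<close>

lemma prob_few_tendsto_Suc:
  assumes p: "0 < p" "p < 1" and h: "1 \<le> h"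
    and lim: "(\<lambda>T. measure_pmf.prob (rs_tree p T) {f. real (deep_count i f T h) < 1}) \<longlonglongrightarrow> 0"
  shows "(\<lambda>T. measure_pmf.prob (rs_tree p T) {f. real (deep_count i f T (h + 1)) < M}) \<longlonglongrightarrow> 0"
proof (rule LIMSEQ_I)
  fix e :: real assume e: "0 < e"
  have "eventually (\<lambda>T. measure_pmf.prob (rs_tree p T) {f. real (deep_count i f T h) < 1} < e / 2) sequentially"
    using lim e by (intro order_tendstoD(2)[OF lim]) auto
  then have "eventually (\<lambda>T. 0 < T \<and> measure_pmf.prob (rs_tree p T) {f. real (deep_count i f T h) < 1} < e / 2) sequentially"
    using eventually_gt_at_top[of 0] by eventually_elim auto
  from eventually_happens'[OF sequentially_bot this] obtain t where t: "0 < t" "measure_pmf.prob (rs_tree p t) {f. real (deep_count i f t h) < 1} < e / 2"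
    by blast
  define g where "g T = (1/2) powr (- M) * exp (- (1/2) * p * ln (real T / real t))" for T
  have "g \<longlonglongrightarrow> 0" unfolding g_def using p t by real_asymp
  then have "eventually (\<lambda>T. g T < e / 2) sequentially" using e by (intro order_tendstoD(2)) auto
  then have "eventually (\<lambda>T. measure_pmf.prob (rs_tree p T) {f. real (deep_count i f T (h + 1)) < M} < e) sequentially"
    using eventually_ge_at_top[of t]
  proof eventually_elim
    case (elim T)
    have "measure_pmf.prob (rs_tree p (t + (T - t))) {f. real (deep_count i f (t + (T - t)) (h + 1)) < M} \<le>
        measure_pmf.prob (rs_tree p t) {f. real (deep_count i f t h) < 1} + g T"
    proof (rule prob_rs_tree_add_le[OF t(1)])
      fix f assume st: "surfer_state f" and "f \<notin> {f. real (deep_count i f t h) < 1}"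
      then have one: "1 \<le> deep_count i f t h" by auto
      have new: "p / real s \<le> measure_pmf.prob (rs_step p s f') {f''. deep i f'' (h + 1) s}"
        if "t \<le> s" "surfer_state f'" and mono: "\<And>h'. deep_count i f t h' \<le> deep_count i f' s h'" for s f'
      proof -
        have "p * 1 \<le> p * real (deep_count i f' s h)" using one mono[of h] p by (intro mult_left_mono) auto
        then have "p / real s \<le> (\<Sum>k<1. p * (1 - p) ^ k * real (deep_count i f' s (h + 1 - 1 + int k))) / real s"
          by (intro divide_right_mono) auto
        also have "\<dots> \<le> measure_pmf.prob (rs_step p s f') {f''. deep i f'' (h + 1) s}"
          using that t h by (intro prob_deep_new_ge p) auto
        finally show ?thesis .
      qed
      have "measure_pmf.prob (rs_run p t (T - t) f) {f'. real (deep_count i f' (t + (T - t)) (h + 1)) < M} \<le>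
        (1/2) powr (real (deep_count i f t (h + 1)) - M) * exp (- (1 - 1/2) * p * ln (real (t + (T - t)) / real t))"
        using p by (intro prob_count_less_le st t new) auto
      also have "\<dots> \<le> (1/2) powr (- M) * exp (- (1 - 1/2) * p * ln (real (t + (T - t)) / real t))"
        by (intro mult_right_mono powr_mono') auto
      also have "\<dots> = g T" using elim by (simp add: g_def)
      finally show "measure_pmf.prob (rs_run p t (T - t) f)
        {f. real (deep_count i f (t + (T - t)) (h + 1)) < M} \<le> g T" .
    qed (simp add: g_def)
    then show ?case using elim t by simp
  qed
  then show "\<exists>no. \<forall>T\<ge>no. norm (measure_pmf.prob (rs_tree p T) {f. real (deep_count i f T (h + 1)) < M} - 0) < e"
    by (simp add: eventually_sequentially)
qed

lemma prob_few_tendsto: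
  assumes p: "0 < p" "p < 1"
  shows "(\<lambda>T. measure_pmf.prob (rs_tree p T) {f. real (deep_count i f T (int H + 2)) < M}) \<longlonglongrightarrow> 0"
proof -
  have "(\<lambda>T. measure_pmf.prob (rs_tree p T) {f. real (deep_count i f T (int H + 1)) < 1}) \<longlonglongrightarrow> 0"
  proof (induction H)
    case 0
    then show ?case using prob_few_True_tendsto prob_few_False_tendsto by (cases i) auto
  next
    case (Suc H)
    then show ?case using prob_few_tendsto_Suc[OF p, of "int H + 1" i 1] by (simp add: add.commute)
  qed
  then show ?thesis using prob_few_tendsto_Suc[OF p, of "int H + 1" i M] by (simp add: add.assoc)
qed

lemma rs_diam_lower:
  assumes p: "0 < p" "p < 1" and \<epsilon>: "0 < \<epsilon>"
  shows "(\<lambda>n. measure_pmf.prob (rs_tree p n)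
    {f. real (rs_diam f n) < (2 * cL p - \<epsilon>) * ln (real n)}) \<longlonglongrightarrow> 0"
proof (rule LIMSEQ_I)
  fix e :: real assume e: "0 < e"
  \<comment> \<open>Positive and below \<open>cL p\<close>, yet strictly above
    \<open>cL p - \<epsilon> / 2\<close>, which leaves room for the constants \<open>ln K\<close>
    and \<open>d * r\<close> when \<open>n\<close> is large.\<close>
  define c0 where "c0 = max (cL p / 2) (cL p - \<epsilon> / 4)"
  have c0: "0 < c0" "c0 < cL p" "cL p - \<epsilon> / 2 < c0"
    using cL_pos[OF p] \<epsilon> by (auto simp: c0_def)
  obtain \<eta> d N r j where j: "0 < \<eta>" "\<eta> < 1" "0 < d" "0 < r" "0 < j"
    "c0 * (real r * d) \<le> real j" "2 \<le> front p N ((1 - \<eta>) * d) r (int j)"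
    using front_reaches[OF p c0(1,2)] .
  note d = j(3)
  obtain C where C: "0 \<le> C" and block: "\<And>t H M i. \<lbrakk>0 < t; int r + 2 \<le> H; 0 < M\<rbrakk> \<Longrightarrow>
    measure_pmf.prob (rs_tree p ((next_time d ^^ r) t))
      {f. real (deep_count i f ((next_time d ^^ r) t) (H + int j)) < 2 * M} \<le>
    measure_pmf.prob (rs_tree p t) {f. real (deep_count i f t H) < M} + C / M"
    using block_success[OF p j(1,2,3,7)] by blast
  \<comment> \<open>Each class then loses less than \<open>e / 4\<close> in the blocks and, after a
    long enough start up to time \<open>T\<close>, less than \<open>e / 4\<close> there.\<close>
  define M where "M = 8 * C / e + 1"
  have M: "1 \<le> M" using C e by (simp add: M_def)
  have "8 * C < M * e" using e by (simp add: M_def field_simps)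
  then have CM: "2 * C / M < e / 4" using M by (simp add: field_simps)
  define H where "H = int r + 2"
  define few where "few i T = measure_pmf.prob (rs_tree p T) {f. real (deep_count i f T H) < M}" for i T
  have "few i \<longlonglongrightarrow> 0" for i unfolding few_def H_def by (rule prob_few_tendsto[OF p])
  then have "eventually (\<lambda>T. few i T < e / 4) sequentially" for i
    using e by (intro order_tendstoD(2)) auto
  from this[of True] this[of False] eventually_gt_at_top[of 0]
  have "eventually (\<lambda>T. 0 < T \<and> few True T < e / 4 \<and> few False T < e / 4) sequentially"
    by eventually_elim auto
  from eventually_happens'[OF sequentially_bot this] obtain T where T: "0 < T" "few True T < e / 4" "few False T < e / 4"
    by blast
  define K where "K = real T + 1 / (exp d - 1)"
  have K: "0 < K" using T d by (simp add: K_def add_pos_pos)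
  have dr: "0 < d * real r" using d j by simp
  have "eventually (\<lambda>n. (cL p - \<epsilon> / 2) * ln (real n) \<le> c0 * (ln (real n) - ln K - d * real r)) sequentially"
    using c0 by real_asymp
  moreover have "eventually (\<lambda>n. K \<le> real n) sequentially" by real_asymp
  ultimately have "eventually (\<lambda>n. measure_pmf.prob (rs_tree p n)
    {f. real (rs_diam f n) < (2 * cL p - \<epsilon>) * ln (real n)} < e) sequentially"
  proof eventually_elim
    case (elim n)
    have n: "0 < n" using elim(2) K by (cases n) auto
    \<comment> \<open>The number of blocks that surely fit: after \<open>m\<close> blocks, rounding
      included, the time is at most \<open>n\<close>. The floor loses less than one block, of
      logarithmic length \<open>d * r\<close>.\<close>
    define m where "m = nat \<lfloor>(ln (real n) - ln K) / (d * real r)\<rfloor>"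
    have "0 \<le> (ln (real n) - ln K) / (d * real r)" using elim(2) K dr n by simp
    then have m: "real m \<le> (ln (real n) - ln K) / (d * real r)"
      "(ln (real n) - ln K) / (d * real r) \<le> real m + 1"
      unfolding m_def by linarith+
    define t where "t = (next_time d ^^ (r * m)) T"
    have "real t \<le> exp (d * real (r * m)) * K"
      using funpow_next_time_le[OF d, of "r * m" T] by (simp add: t_def K_def)
    also have "d * real (r * m) \<le> ln (real n) - ln K"
      using m(1) dr by (simp add: pos_le_divide_eq mult_ac)
    then have "exp (d * real (r * m)) * K \<le> exp (ln (real n) - ln K) * K" using K by simp
    also have "\<dots> = real n" using K n by (simp add: exp_diff)
    finally have tn: "t \<le> n" by simp
    have t: "0 < t" using funpow_next_time_ge[OF d, of T "r * m"] T by (simp add: t_def)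
    have "ln (real n) - ln K - d * real r \<le> real m * (d * real r)"
      using m(2) dr by (simp add: pos_divide_le_eq algebra_simps)
    then have "c0 * (ln (real n) - ln K - d * real r) \<le> c0 * (real m * (d * real r))"
      using c0 by (intro mult_left_mono) auto
    also have "\<dots> = real m * (c0 * (real r * d))" by simp
    also have "\<dots> \<le> real m * real j" using j by (intro mult_left_mono) auto
    finally have "(cL p - \<epsilon> / 2) * ln (real n) \<le> real (j * m)" using elim(1) by (simp add: mult.commute)
    then have height: "(2 * cL p - \<epsilon>) * ln (real n) \<le> 2 * real (j * m)" by (simp add: algebra_simps)
    \<comment> \<open>The steps between the end of the last block and \<open>n\<close> only add
      vertices, so a deep vertex of class \<open>i\<close> persists.\<close>
    have side: "measure_pmf.prob (rs_tree p n) {f. deep_count i f n (int (j * m)) = 0} \<le> few i T + 2 * C / M" for i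
    proof -
      have "measure_pmf.prob (rs_tree p (t + (n - t))) {f. deep_count i f (t + (n - t)) (int (j * m)) = 0} \<le>
          measure_pmf.prob (rs_tree p t) {f. real (deep_count i f t (H + int (j * m))) < 2 ^ m * M} + 0"
      proof (rule prob_rs_tree_add_le[OF t order_refl])
        fix f assume st: "surfer_state f"
          and "f \<notin> {f. real (deep_count i f t (H + int (j * m))) < 2 ^ m * M}"
        then have "2 ^ m * M \<le> real (deep_count i f t (H + int (j * m)))" by simp
        moreover have "0 < 2 ^ m * M" using M by simp
        ultimately have "0 < deep_count i f t (H + int (j * m))" by linarith
        also have "\<dots> \<le> deep_count i f t (int (j * m))" by (intro deep_count_antimono) (simp add: H_def)
        finally have "deep_count i f' (t + (n - t)) (int (j * m)) \<noteq> 0"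
          if "f' \<in> set_pmf (rs_run p t (n - t) f)" for f'
          using rs_run_set(2)[OF st t that, of i "int (j * m)"] by linarith
        then have "measure_pmf.prob (rs_run p t (n - t) f)
            {f. deep_count i f (t + (n - t)) (int (j * m)) = 0} = 0"
          by (subst measure_pmf_zero_iff) blast
        then show "measure_pmf.prob (rs_run p t (n - t) f)
            {f. deep_count i f (t + (n - t)) (int (j * m)) = 0} \<le> 0" by simp
      qed
      also have "\<dots> \<le> few i T + 2 * C / M"
        using blocks_success[where i = i and H = H and M = M and n = m, OF d C block T(1)] M
        by (simp add: t_def few_def H_def)
      finally show ?thesis using tn by simp
    qed
    have "measure_pmf.prob (rs_tree p n) {f. real (rs_diam f n) < (2 * cL p - \<epsilon>) * ln (real n)} \<le>
        measure_pmf.prob (rs_tree p n) {f. \<exists>i\<in>{True, False}. deep_count i f n (int (j * m)) = 0}"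
    proof (rule measure_pmf.finite_measure_mono_AE)
      show "AE f in rs_tree p n. f \<in> {f. real (rs_diam f n) < (2 * cL p - \<epsilon>) * ln (real n)} \<longrightarrow>
          f \<in> {f. \<exists>i\<in>{True, False}. deep_count i f n (int (j * m)) = 0}"
      proof (rule AE_pmfI, intro impI, rule ccontr)
        fix f assume f: "f \<in> set_pmf (rs_tree p n)"
          and less: "f \<in> {f. real (rs_diam f n) < (2 * cL p - \<epsilon>) * ln (real n)}"
          and pos: "f \<notin> {f. \<exists>i\<in>{True, False}. deep_count i f n (int (j * m)) = 0}"
        from pos have "0 < deep_count True f n (int (j * m))" "0 < deep_count False f n (int (j * m))"
          by (simp_all only: mem_Collect_eq bex_simps ball_simps not_gr0[symmetric] insert_iff) blast+
        then have "2 * (j * m) \<le> rs_diam f n" by (rule rs_diam_ge[OF rs_tree_set(2)[OF n f]])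
        then have "2 * real (j * m) \<le> real (rs_diam f n)" by linarith
        then show False using less height by simp
      qed
    qed auto
    also have "\<dots> \<le> (\<Sum>i\<in>{True, False}. measure_pmf.prob (rs_tree p n) {f. deep_count i f n (int (j * m)) = 0})"
      by (rule prob_Bex_le_sum) simp
    also have "\<dots> \<le> (few True T + 2 * C / M) + (few False T + 2 * C / M)"
      using side[of True] side[of False] by simp
    also have "\<dots> < e" using T CM by linarith
    finally show ?case .
  qed
  then show "\<exists>no. \<forall>n\<ge>no. norm (measure_pmf.prob (rs_tree p n)
      {f. real (rs_diam f n) < (2 * cL p - \<epsilon>) * ln (real n)} - 0) < e"
    by (simp add: eventually_sequentially)
qed

theorem theorem3:
  fixes p \<epsilon> :: real
  assumes "0 < p" and "p < 1" and "0 < \<epsilon>"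
  shows "(\<lambda>n. measure_pmf.prob (rs_tree p n)
            {f. (2 * cL p - \<epsilon>) * ln (real n) \<le> real (rs_diam f n) \<and>
                real (rs_diam f n) \<le> (2 * cU p + \<epsilon>) * ln (real n)})
         \<longlonglongrightarrow> 1"
proof -
  define lo where "lo n = {f. real (rs_diam f n) < (2 * cL p - \<epsilon>) * ln (real n)}" for n
  define hi where "hi n = {f. (2 * cU p + \<epsilon>) * ln (real n) < real (rs_diam f n)}" for n
  have compl: "{f. (2 * cL p - \<epsilon>) * ln (real n) \<le> real (rs_diam f n) \<and>
      real (rs_diam f n) \<le> (2 * cU p + \<epsilon>) * ln (real n)} = - (lo n \<union> hi n)" for n
    by (auto simp: lo_def hi_def)
  have "(\<lambda>n. measure_pmf.prob (rs_tree p n) (lo n) + measure_pmf.prob (rs_tree p n) (hi n)) \<longlonglongrightarrow> 0 + 0"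
    unfolding lo_def hi_def by (intro tendsto_add rs_diam_lower rs_diam_upper assms)
  then have "(\<lambda>n. 1 - (measure_pmf.prob (rs_tree p n) (lo n) + measure_pmf.prob (rs_tree p n) (hi n))) \<longlonglongrightarrow> 1 - (0 + 0)"
    by (intro tendsto_diff tendsto_const)
  then have lim: "(\<lambda>n. 1 - (measure_pmf.prob (rs_tree p n) (lo n) + measure_pmf.prob (rs_tree p n) (hi n))) \<longlonglongrightarrow> 1"
    by simp
  show ?thesis
    unfolding compl
  proof (rule tendsto_sandwich[OF _ _ lim tendsto_const])
    have "1 - (measure_pmf.prob (rs_tree p n) (lo n) + measure_pmf.prob (rs_tree p n) (hi n)) \<le>
        measure_pmf.prob (rs_tree p n) (- (lo n \<union> hi n))" for n
      using measure_Un_le[of "lo n" "measure_pmf (rs_tree p n)" "hi n"]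
        measure_pmf.prob_compl[of "lo n \<union> hi n" "rs_tree p n"] by (simp add: Compl_eq_Diff_UNIV)
    then show "eventually (\<lambda>n. 1 - (measure_pmf.prob (rs_tree p n) (lo n) + measure_pmf.prob (rs_tree p n) (hi n)) \<le>
        measure_pmf.prob (rs_tree p n) (- (lo n \<union> hi n))) sequentially" by simp
  qed simp
qed

end
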